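(* Let $K$ be a non-empty compact Hausdorff topological space, let $Y$ be a non-zero Banach space over $\mathbb{K}$, and let $f,g\in C(K,Y)$. Then $$f\perp_B g\iff 0\in\operatorname{conv}\{y^*(g(t))\colon t\in K,\ y^*\in\operatorname{ext}(B_{Y^*}),\ y^*(f(t))=\|f\|\}.$$ Moreover, $f\in C(K,Y)$ is a smooth point of $C(K,Y)$ if and only if the set $$\{y^*(g(t))\colon t\in K,\ y^*\in\operatorname{ext}(B_{Y^*}),\ y^*(f(t))=\|f\|\}$$ is a singleton for every $g\in C(K,Y)$.
   Context: $\mathbb{K}$ is $\mathbb{R}$ or $\mathbb{C}$. $C(K,Y)$ is the Banach space of continuous functions from $K$ to $Y$ with the supremum norm. $B_{Y^*}$ is the closed unit ball of the dual $Y^*$, $\operatorname{ext}$ denotes the set of extreme points, $\operatorname{conv}$ the convex hull. $x\perp_B y$ (Birkhoff-James orthogonality) means $\|x+\lambda y\|\geq\|x\|$ for all $\lambda\in\mathbb{K}$. A point $z$ of a Banach space $Z$ is smooth if $\{\phi\in Z^*\colon\|\phi\|=1,\ \phi(z)=\|z\|\}$ is a singleton. *)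

theory Defs
  imports "HOL-Analysis.Analysis"
begin

text \<open>
  The scalar field is \<open>\<real>\<close> or \<open>\<complex>\<close>: the two alternatives below say that a type of the
  class is isomorphic, as a normed field, to one of these.
\<close>

class real_or_complex = real_normed_field +
  assumes real_or_complex:
    "(\<forall>z. \<exists>a. z = a *\<^sub>R 1) \<or>
     (\<exists>i. i * i = - 1 \<and> (\<forall>z. \<exists>a b. z = a *\<^sub>R 1 + b *\<^sub>R i \<and> norm z = sqrt (a\<^sup>2 + b\<^sup>2)))"

instance real :: real_or_complex
  by standard simp

instance complex :: real_or_complex
proof (standard, rule disjI2, intro exI[of _ \<i>] conjI allI)
  fix z :: complex
  show "\<exists>a b. z = a *\<^sub>R 1 + b *\<^sub>R \<i> \<and> norm z = sqrt (a\<^sup>2 + b\<^sup>2)"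
    by (rule exI[of _ "Re z"], rule exI[of _ "Im z"])
      (simp add: complex_eq_iff cmod_def)
qed simp

text \<open>
  The library has only real normed spaces. One over the scalar field \<open>'k\<close> is a real one
  with a multiplication by scalars in \<open>'k\<close> that extends the real one and for which the
  norm is homogeneous. For \<open>'k = real\<close>, \<open>smul\<close> is necessarily \<open>scaleR\<close>. Such a space
  is a Banach space if its type belongs to the class \<open>banach\<close>.
\<close>

locale normed_over = vector_space smul
  for smul :: "'k::real_or_complex \<Rightarrow> 'y::real_normed_vector \<Rightarrow> 'y" +
  assumes scale_of_real: "smul (of_real r) y = r *\<^sub>R y"
    and norm_scale: "norm (smul c y) = norm c * norm y"

text \<open>For compact \<open>'t\<close>, the space \<open>C('t, 'y)\<close> is the library's \<open>'t \<Rightarrow>\<^sub>C 'y\<close>.\<close>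

definition bcontfun_scale ::
    "('k \<Rightarrow> 'y \<Rightarrow> 'y) \<Rightarrow> 'k \<Rightarrow> ('t::topological_space \<Rightarrow>\<^sub>C 'y::metric_space) \<Rightarrow> ('t \<Rightarrow>\<^sub>C 'y)"
  where "bcontfun_scale smul c f = Bcontfun (\<lambda>t. smul c (apply_bcontfun f t))"

context normed_over
begin

lemma bounded_linear_scale: "bounded_linear (smul c)"
proof (rule bounded_linear_intro[where K = "norm c"])
  fix r x
  have "smul c (smul (of_real r) x) = smul (of_real r) (smul c x)"
    by (simp only: scale_scale mult.commute)
  then show "smul c (r *\<^sub>R x) = r *\<^sub>R smul c x"
    by (simp only: scale_of_real)
qed (simp_all add: scale_right_distrib norm_scale mult.commute)

lemma apply_bcontfun_scale [simp]:
  "apply_bcontfun (bcontfun_scale smul c f) t = smul c (apply_bcontfun f t)"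
proof -
  have "(\<lambda>t. smul c (apply_bcontfun f t)) \<in> bcontfun"
    unfolding bcontfun_def
    using bounded_linear_image[OF bounded_apply_bcontfun[of f] bounded_linear_scale[of c]]
    by (auto intro!: bounded_linear.continuous_on[OF bounded_linear_scale] simp: image_image)
  then show ?thesis
    by (simp add: bcontfun_scale_def Bcontfun_inverse)
qed

lemma norm_apply_bcontfun_le: "norm (apply_bcontfun (f :: 't::topological_space \<Rightarrow>\<^sub>C 'y) t) \<le> norm f"
  using dist_bounded[of f t 0] by simp

lemma norm_bcontfun_scale:
  "norm (bcontfun_scale smul c f) = norm c * norm (f :: 't::topological_space \<Rightarrow>\<^sub>C 'y)"
proof -
  have le: "norm (bcontfun_scale smul c f) \<le> norm c * norm f"
    for c and f :: "'t \<Rightarrow>\<^sub>C 'y"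
  proof -
    have "dist (bcontfun_scale smul c f) 0 \<le> norm c * norm f"
      by (rule dist_bound) (simp add: norm_scale mult_left_mono norm_apply_bcontfun_le)
    then show ?thesis by simp
  qed
  show ?thesis
  proof (cases "c = 0")
    case True
    then show ?thesis using le[of c f] by simp
  next
    case False
    have "bcontfun_scale smul (inverse c) (bcontfun_scale smul c f) = f"
      using False by (intro bcontfun_eqI) simp
    then have "norm f \<le> norm (inverse c) * norm (bcontfun_scale smul c f)"
      using le[of "inverse c" "bcontfun_scale smul c f"] by simp
    then have "norm c * norm f \<le> norm (bcontfun_scale smul c f)"
      using False by (simp add: norm_divide field_simps)
    then show ?thesis using le[of c f] by simp
  qed
qed

lemma normed_over_bcontfun:
  "normed_over (bcontfun_scale smul :: 'k \<Rightarrow> ('t::topological_space \<Rightarrow>\<^sub>C 'y) \<Rightarrow> _)"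
  by unfold_locales
    (auto intro!: bcontfun_eqI
      simp: scale_right_distrib scale_left_distrib scale_of_real norm_bcontfun_scale)

end

definition birkhoff_james ::
    "('k \<Rightarrow> 'z \<Rightarrow> 'z) \<Rightarrow> 'z::real_normed_vector \<Rightarrow> 'z \<Rightarrow> bool"
  where "birkhoff_james smul x y \<longleftrightarrow> (\<forall>c. norm (x + smul c y) \<ge> norm x)"

text \<open>
  The \<open>'k\<close>-linear functionals among the real-linear bounded maps; the norm is the one
  of \<open>'z \<Rightarrow>\<^sub>L 'k\<close>, the operator norm.
\<close>

definition dual :: "('k \<Rightarrow> 'z \<Rightarrow> 'z) \<Rightarrow> ('z::real_normed_vector \<Rightarrow>\<^sub>L 'k::real_or_complex) set"
  where "dual smul = {\<phi>. \<forall>c z. blinfun_apply \<phi> (smul c z) = c * blinfun_apply \<phi> z}"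

definition dual_ball :: "('k \<Rightarrow> 'z \<Rightarrow> 'z) \<Rightarrow> ('z::real_normed_vector \<Rightarrow>\<^sub>L 'k::real_or_complex) set"
  where "dual_ball smul = {\<phi> \<in> dual smul. norm \<phi> \<le> 1}"

definition smooth_point ::
    "('k::real_or_complex \<Rightarrow> 'z \<Rightarrow> 'z) \<Rightarrow> 'z::real_normed_vector \<Rightarrow> bool"
  where "smooth_point smul z \<longleftrightarrow>
    is_singleton {\<phi> \<in> dual smul. norm \<phi> = 1 \<and> blinfun_apply \<phi> z = of_real (norm z)}"

definition extreme_values ::
    "('k::real_or_complex \<Rightarrow> 'y \<Rightarrow> 'y) \<Rightarrow>
     ('t::topological_space \<Rightarrow>\<^sub>C 'y::real_normed_vector) \<Rightarrow> ('t \<Rightarrow>\<^sub>C 'y) \<Rightarrow> 'k set"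
  where "extreme_values smul f g =
    {blinfun_apply \<psi> (apply_bcontfun g t) | t \<psi>.
      \<psi> extreme_point_of dual_ball smul \<and>
      blinfun_apply \<psi> (apply_bcontfun f t) = of_real (norm f)}"

end

theory Submission
  imports Defs
begin

text \<open>
  For fixed \<open>t\<close>, the values \<open>\<psi> (g t)\<close> of the functionals \<open>\<psi>\<close> in the dual ball with
  \<open>\<psi> (f t) = \<parallel>f\<parallel>\<close> form a convex compact set of scalars, which by Hahn-Banach is cut out
  by the half planes \<open>Re (c z) \<le> \<parallel>c g t + s f t\<parallel> - s \<parallel>f\<parallel>\<close>, \<open>s \<ge> 0\<close>. This description
  depends continuously on \<open>t\<close>, so the union over \<open>t\<close> is compact without any appeal to
  the weak-* topology. By Minkowski's theorem in the plane, each of the sets is the convex hull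
  of its extreme points, and the functionals over such an extreme point form a face of the
  dual ball, which contains an extreme point of the ball. Hence the convex hull of the extreme
  values is compact. If it misses 0, a separating direction \<open>c\<close> contradicts the fact that
  \<open>f\<close> orthogonal to \<open>g\<close> yields, by compactness, a \<open>t\<close> with
  \<open>\<parallel>s f t + c g t\<parallel> \<ge> s \<parallel>f\<parallel>\<close> for all \<open>s \<ge> 0\<close>.

  Extreme points are found by applying Zorn's lemma to sublinear functionals: a minimal
  sublinear functional whose dominated linear functionals form a face is itself linear.

  For the smoothness criterion, a norming functional \<open>\<phi>\<close> of \<open>f\<close> satisfies
  \<open>\<phi> k = 0\<close> for \<open>k = h - (\<phi> h / \<parallel>f\<parallel>) f\<close>. So \<open>f\<close> is orthogonal to \<open>k\<close>, and the
  first part identifies \<open>\<phi> h\<close> with the unique extreme value at \<open>h\<close>.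
\<close>

section \<open>Sublinear functionals and their dominated linear functionals\<close>

definition sublinear :: "('a::real_vector \<Rightarrow> real) \<Rightarrow> bool"
  where "sublinear q \<longleftrightarrow> (\<forall>x y. q (x + y) \<le> q x + q y) \<and> (\<forall>c x. c \<ge> 0 \<longrightarrow> q (c *\<^sub>R x) = c * q x)"

text \<open>For \<open>q = norm\<close> this is the unit ball of the real dual. The convex sets of
  functionals below are given by a sublinear bound, so that intersecting a chain of them becomes a
  pointwise infimum.\<close>

definition dominated :: "('a::real_vector \<Rightarrow> real) \<Rightarrow> ('a \<Rightarrow> real) set"
  where "dominated q = {u. linear u \<and> (\<forall>x. u x \<le> q x)}"

text \<open>An extreme subset, without convexity of \<open>F\<close> being demanded;
  \<open>functional_face {u} D\<close> says that \<open>u\<close> is an extreme point of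
  \<open>D\<close>.\<close>

definition functional_face :: "('a \<Rightarrow> real) set \<Rightarrow> ('a \<Rightarrow> real) set \<Rightarrow> bool"
  where "functional_face F D \<longleftrightarrow> F \<subseteq> D \<and>
    (\<forall>u\<in>D. \<forall>v\<in>D. \<forall>s. 0 < s \<and> s < 1 \<and> (\<lambda>x. (1 - s) * u x + s * v x) \<in> F \<longrightarrow> u \<in> F \<and> v \<in> F)"

section \<open>Faces of sets of linear functionals\<close>

lemma functional_faceD:
  assumes "functional_face F D" "u \<in> D" "v \<in> D" "0 < s" "s < 1"
    and "(\<lambda>x. (1 - s) * u x + s * v x) \<in> F"
  shows "u \<in> F \<and> v \<in> F"
  using assms unfolding functional_face_def by blast

lemma functional_face_refl: "functional_face D D"
  by (simp add: functional_face_def)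

lemma functional_face_trans:
  assumes "functional_face E F" "functional_face F D"
  shows "functional_face E D"
  unfolding functional_face_def
proof (intro conjI ballI allI impI)
  show "E \<subseteq> D" using assms unfolding functional_face_def by blast
  fix u v s
  assume "u \<in> D" "v \<in> D" and s: "0 < s \<and> s < 1 \<and> (\<lambda>x. (1 - s) * u x + s * v x) \<in> E"
  moreover have "(\<lambda>x. (1 - s) * u x + s * v x) \<in> F"
    using s assms(1) unfolding functional_face_def by blast
  ultimately have "u \<in> F" "v \<in> F"
    using s assms(2) unfolding functional_face_def by blast+
  then show "u \<in> E" "v \<in> E"
    using s assms(1) unfolding functional_face_def by blast+
qed

lemma functional_face_INT:
  assumes "\<And>i. i \<in> I \<Longrightarrow> functional_face (F i) D" "I \<noteq> {}"
  shows "functional_face (\<Inter>i\<in>I. F i) D"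
  unfolding functional_face_def
proof (intro conjI ballI allI impI)
  show "(\<Inter>i\<in>I. F i) \<subseteq> D" using assms unfolding functional_face_def by blast
  fix u v s
  assume D: "u \<in> D" "v \<in> D" and s: "0 < s \<and> s < 1 \<and> (\<lambda>x. (1 - s) * u x + s * v x) \<in> (\<Inter>i\<in>I. F i)"
  have "u \<in> F i \<and> v \<in> F i" if i: "i \<in> I" for i
  proof -
    have "(\<lambda>x. (1 - s) * u x + s * v x) \<in> F i" using s i by blast
    then show ?thesis using D s assms(1)[OF i] unfolding functional_face_def by blast
  qed
  then show "u \<in> (\<Inter>i\<in>I. F i)" "v \<in> (\<Inter>i\<in>I. F i)" by blast+
qed

text \<open>The scaling inequality for \<open>inverse c\<close> at \<open>c *\<^sub>R x\<close> is
  the reverse of the one for \<open>c\<close>.\<close>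

lemma sublinearI:
  assumes add: "\<And>x y. q (x + y) \<le> q x + q y"
    and zero: "q 0 = 0"
    and scale: "\<And>c x. c > 0 \<Longrightarrow> q (c *\<^sub>R x) \<le> c * q x"
  shows "sublinear q"
  unfolding sublinear_def
proof (intro conjI allI impI add)
  fix c :: real and x assume "c \<ge> 0"
  show "q (c *\<^sub>R x) = c * q x"
  proof (cases "c = 0")
    case False
    with \<open>c \<ge> 0\<close> have c: "c > 0" by simp
    have "q (inverse c *\<^sub>R (c *\<^sub>R x)) \<le> inverse c * q (c *\<^sub>R x)"
      using c by (intro scale) simp
    then have "c * q x \<le> q (c *\<^sub>R x)"
      using c by (simp add: field_simps)
    with scale[OF c] show ?thesis by (simp add: antisym)
  qed (simp add: zero)
qed

lemma sublinear_add: "sublinear q \<Longrightarrow> q (x + y) \<le> q x + q y"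
  and sublinear_scale: "sublinear q \<Longrightarrow> c \<ge> 0 \<Longrightarrow> q (c *\<^sub>R x) = c * q x"
  by (auto simp: sublinear_def)

lemma sublinear_zero: "sublinear q \<Longrightarrow> q 0 = 0"
  using sublinear_scale[of q 0 0] by simp

lemma sublinear_minus_le: "sublinear q \<Longrightarrow> - q (- x) \<le> q x"
  using sublinear_add[of q x "- x"] sublinear_zero[of q] by simp

lemma sublinear_norm: "sublinear norm"
  by (rule sublinearI) (simp_all add: norm_triangle_ineq)

text \<open>Oddness turns subadditivity at \<open>- x\<close> and \<open>- y\<close> into
  superadditivity at \<open>x\<close> and \<open>y\<close>.\<close>

lemma linear_of_odd_sublinear:
  assumes q: "sublinear q" and odd: "\<And>x. q (- x) = - q x"
  shows "linear q"
proof (rule linearI)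
  fix x y
  have "q (- x + - y) \<le> q (- x) + q (- y)" by (rule sublinear_add[OF q])
  then have "q x + q y \<le> q (x + y)"
    using odd[of "x + y"] odd[of x] odd[of y] by simp
  then show "q (x + y) = q x + q y" using sublinear_add[OF q, of x y] by simp
next
  fix c x
  show "q (c *\<^sub>R x) = c *\<^sub>R q x"
  proof (cases "c \<ge> 0")
    case True
    then show ?thesis using sublinear_scale[OF q] by simp
  next
    case False
    then have "q ((- c) *\<^sub>R x) = - c * q x" by (intro sublinear_scale[OF q]) simp
    then show ?thesis using odd[of "c *\<^sub>R x"] by simp
  qed
qed

text \<open>Supplies the lower bounds of chains for Zorn's lemma. Two members of a chain are
  comparable, so the smaller one bounds the infimum at \<open>x + y\<close> in terms of
  both.\<close>

lemma sublinear_chain_INF: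
  assumes sub: "\<And>r. r \<in> C \<Longrightarrow> sublinear r" and le: "\<And>r. r \<in> C \<Longrightarrow> r \<le> q"
    and chain: "\<And>r r'. r \<in> C \<Longrightarrow> r' \<in> C \<Longrightarrow> r \<le> r' \<or> r' \<le> r" and ne: "C \<noteq> {}"
  defines "i \<equiv> \<lambda>x. INF r\<in>C. r x"
  shows "sublinear i" and "\<And>r. r \<in> C \<Longrightarrow> i \<le> r" and "dominated i = (\<Inter>r\<in>C. dominated r)"
proof -
  have bdd: "bdd_below ((\<lambda>r. r x) ` C)" for x
  proof (rule bdd_belowI2)
    fix r assume r: "r \<in> C"
    show "- q (- x) \<le> r x"
      using sublinear_minus_le[OF sub[OF r], of x] le_funD[OF le[OF r], of "- x"] by linarith
  qed
  have lower: "i x \<le> r x" if "r \<in> C" for r x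
    unfolding i_def by (rule cINF_lower[OF bdd that])
  show "i \<le> r" if "r \<in> C" for r
    using lower[OF that] by (simp add: le_fun_def)
  have greatest: "c \<le> i x" if "\<And>r. r \<in> C \<Longrightarrow> c \<le> r x" for c x
    unfolding i_def using ne that by (rule cINF_greatest)
  show "sublinear i"
  proof (rule sublinearI)
    fix x y
    have "i (x + y) \<le> r x + r' y" if r: "r \<in> C" "r' \<in> C" for r r'
    proof -
      obtain s where s: "s \<in> C" "s \<le> r" "s \<le> r'"
        using chain[OF r] r order_refl by blast
      have "i (x + y) \<le> s x + s y"
        using lower[OF s(1), of "x + y"] sublinear_add[OF sub[OF s(1)], of x y] by linarith
      then show ?thesis using le_funD[OF s(2), of x] le_funD[OF s(3), of y] by linarith
    qed
    note bound = this
    \<comment> \<open>The infimum over \<open>r'\<close> is taken first, the one over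
      \<open>r\<close> afterwards.\<close>
    have "i (x + y) - r x \<le> i y" if r: "r \<in> C" for r
    proof (rule greatest)
      fix r' assume "r' \<in> C"
      from bound[OF r this] show "i (x + y) - r x \<le> r' y" by linarith
    qed
    then have "i (x + y) - i y \<le> i x"
      by (intro greatest) (simp add: algebra_simps)
    then show "i (x + y) \<le> i x + i y" by simp
  next
    show "i 0 = 0"
      using ne sub by (simp add: i_def sublinear_zero cong: INF_cong_simp)
  next
    fix c :: real and x assume c: "c > 0"
    have "i (c *\<^sub>R x) / c \<le> i x"
    proof (rule greatest)
      fix r assume r: "r \<in> C"
      show "i (c *\<^sub>R x) / c \<le> r x"
        using lower[OF r, of "c *\<^sub>R x"] sublinear_scale[OF sub[OF r], of c x] c
        by (simp add: field_simps)
    qed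
    then show "i (c *\<^sub>R x) \<le> c * i x" using c by (simp add: field_simps)
  qed
  show "dominated i = (\<Inter>r\<in>C. dominated r)"
  proof (intro equalityI subsetI)
    fix u assume "u \<in> dominated i"
    then show "u \<in> (\<Inter>r\<in>C. dominated r)"
      using lower unfolding dominated_def by (auto intro: order_trans)
  next
    fix u assume u: "u \<in> (\<Inter>r\<in>C. dominated r)"
    then have "u x \<le> i x" for x by (intro greatest) (auto simp: dominated_def)
    then show "u \<in> dominated i" using u ne by (auto simp: dominated_def)
  qed
qed

text \<open>A construction in the style of Hahn-Banach: the constraints \<open>r \<le> u m\<close>
  for a convex cone \<open>M\<close> of pairs are absorbed by passing to the infimum of
  \<open>q (x + m) - r\<close>. The consistency condition \<open>r \<le> q m\<close> keeps it
  finite.\<close>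

lemma sublinear_cone_constraint:
  assumes q: "sublinear q"
    and zero: "(0, 0) \<in> M"
    and add: "\<And>m r m' r'. (m, r) \<in> M \<Longrightarrow> (m', r') \<in> M \<Longrightarrow> (m + m', r + r') \<in> M"
    and scale: "\<And>c m r. c > 0 \<Longrightarrow> (m, r) \<in> M \<Longrightarrow> (c *\<^sub>R m, c * r) \<in> M"
    and le: "\<And>m r. (m, r) \<in> M \<Longrightarrow> r \<le> q m"
  obtains q' where "sublinear q'" "q' \<le> q"
    "dominated q' = {u \<in> dominated q. \<forall>(m, r)\<in>M. r \<le> u m}"
    "\<And>m r. (m, r) \<in> M \<Longrightarrow> q' (- m) \<le> - r"
proof -
  define q' where "q' x = (INF (m, r)\<in>M. q (x + m) - r)" for x
  have bdd: "bdd_below ((\<lambda>(m, r). q (x + m) - r) ` M)" for x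
  proof (rule bdd_belowI2)
    fix p assume "p \<in> M"
    moreover obtain m r where [simp]: "p = (m, r)" by (cases p)
    \<comment> \<open>Splitting \<open>m\<close> as \<open>(x + m) + (- x)\<close> gives a lower
      bound independent of the pair.\<close>
    moreover have "q m \<le> q (x + m) + q (- x)"
      using sublinear_add[OF q, of "x + m" "- x"] by simp
    ultimately show "- q (- x) \<le> (case p of (m, r) \<Rightarrow> q (x + m) - r)" using le[of m r] by simp
  qed
  have lower: "q' x \<le> q (x + m) - r" if "(m, r) \<in> M" for x m r
    unfolding q'_def using cINF_lower[OF bdd that] by simp
  have greatest: "c \<le> q' x" if "\<And>m r. (m, r) \<in> M \<Longrightarrow> c \<le> q (x + m) - r" for c x
    unfolding q'_def using zero that by (intro cINF_greatest) auto
  have "sublinear q'"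
  proof (rule sublinearI)
    fix x y
    have "q' (x + y) \<le> (q (x + m) - r) + (q (y + m') - r')" if "(m, r) \<in> M" "(m', r') \<in> M" for m r m' r'
    proof -
      have "q' (x + y) \<le> q ((x + y) + (m + m')) - (r + r')"
        by (intro lower add that)
      also have "(x + y) + (m + m') = (x + m) + (y + m')" by simp
      also have "q ((x + m) + (y + m')) - (r + r') \<le> (q (x + m) - r) + (q (y + m') - r')"
        using sublinear_add[OF q, of "x + m" "y + m'"] by linarith
      finally show ?thesis .
    qed
    note bound = this
    have "q' (x + y) - (q (x + m) - r) \<le> q' y" if mr: "(m, r) \<in> M" for m r
    proof (rule greatest)
      fix m' r' assume "(m', r') \<in> M"
      from bound[OF mr this] show "q' (x + y) - (q (x + m) - r) \<le> q (y + m') - r'" by linarith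
    qed
    then have "q' (x + y) - q' y \<le> q' x"
      by (intro greatest) (simp only: diff_le_eq add.commute)
    then show "q' (x + y) \<le> q' x + q' y" by simp
  next
    have "0 \<le> q' 0" using le by (intro greatest) simp
    then show "q' 0 = 0" using lower[OF zero, of 0] sublinear_zero[OF q] by simp
  next
    fix c :: real and x assume c: "c > 0"
    have "q' (c *\<^sub>R x) / c \<le> q' x"
    proof (rule greatest)
      fix m r assume "(m, r) \<in> M"
      from lower[OF scale[OF c this], of "c *\<^sub>R x"]
      have "q' (c *\<^sub>R x) \<le> q (c *\<^sub>R (x + m)) - c * r" by (simp add: scaleR_add_right)
      then show "q' (c *\<^sub>R x) / c \<le> q (x + m) - r"
        using c sublinear_scale[OF q, of c "x + m"] by (simp add: field_simps)
    qed
    then show "q' (c *\<^sub>R x) \<le> c * q' x" using c by (simp add: field_simps)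
  qed
  moreover have "q' x \<le> q x" for x using lower[OF zero, of x] by simp
  then have q'_le: "q' \<le> q" by (simp add: le_fun_def)
  moreover have minus: "q' (- m) \<le> - r" if "(m, r) \<in> M" for m r
    using lower[OF that, of "- m"] sublinear_zero[OF q] by simp
  moreover have "dominated q' = {u \<in> dominated q. \<forall>(m, r)\<in>M. r \<le> u m}"
  proof (intro equalityI subsetI CollectI conjI)
    fix u assume u: "u \<in> dominated q'"
    then show "u \<in> dominated q" using q'_le unfolding dominated_def le_fun_def by (auto intro: order_trans)
    have "r \<le> u m" if "(m, r) \<in> M" for m r
    proof -
      have "u (- m) \<le> - r" using u minus[OF that] unfolding dominated_def by (auto intro: order_trans)
      moreover have "u (- m) = - u m" using u by (simp add: dominated_def linear_neg)
      ultimately show ?thesis by simp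
    qed
    then show "\<forall>(m, r)\<in>M. r \<le> u m" by blast
  next
    fix u assume u: "u \<in> {u \<in> dominated q. \<forall>(m, r)\<in>M. r \<le> u m}"
    have "u x \<le> q' x" for x
    proof (rule greatest)
      fix m r assume "(m, r) \<in> M"
      then have "r \<le> u m" using u by blast
      moreover have "u x + u m \<le> q (x + m)" using u by (auto simp: dominated_def simp flip: linear_add)
      ultimately show "u x \<le> q (x + m) - r" by simp
    qed
    then show "u \<in> dominated q'" using u by (simp add: dominated_def)
  qed
  ultimately show ?thesis using that by blast
qed

text \<open>For a minimal \<open>m\<close> and any \<open>y\<close>, the face of functionals with
  value \<open>m y\<close> at \<open>y\<close> has a sublinear bound \<open>m'\<close> below
  \<open>m\<close>. Minimality gives \<open>m' = m\<close> and so
  \<open>m (- y) \<le> - m y\<close>. Hence \<open>m\<close> is odd, therefore linear, and dominates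
  only itself.\<close>

lemma extreme_dominated_exists:
  assumes q: "sublinear q"
  obtains u where "functional_face {u} (dominated q)"
proof -
  define A where "A = {r. sublinear r \<and> r \<le> q \<and> functional_face (dominated r) (dominated q)}"
  have "\<exists>m\<in>A. \<forall>a\<in>A. a \<le> m \<longrightarrow> a = m"
  \<comment> \<open>The order is reversed, so that a maximal element is a minimal
    functional.\<close>
  proof (rule predicate_Zorn[where P = "\<lambda>a b. b \<le> a"])
    show "partial_order_on A (relation_of (\<lambda>a b. b \<le> a) A)"
      by (rule partial_order_on_relation_ofI) auto
  next
    fix C assume C: "C \<in> Chains (relation_of (\<lambda>a b. b \<le> a) A)"
    show "\<exists>u\<in>A. \<forall>a\<in>C. u \<le> a"
    proof (cases "C = {}")
      case True
      have "q \<in> A" using q by (simp add: A_def functional_face_refl)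
      with True show ?thesis by blast
    next
      case False
      have CA: "C \<subseteq> A" by (rule Chains_relation_of[OF C])
      have chain: "r \<le> r' \<or> r' \<le> r" if "r \<in> C" "r' \<in> C" for r r'
        using C that unfolding Chains_def relation_of_def by blast
      define i where "i x = (INF r\<in>C. r x)" for x
      have sub: "sublinear r" and le: "r \<le> q" and face: "functional_face (dominated r) (dominated q)"
        if "r \<in> C" for r
        using CA that by (auto simp: A_def)
      note inf = sublinear_chain_INF[OF sub le chain False, folded i_def]
      obtain r where "r \<in> C" using False by blast
      then have "i \<le> q" using inf(2) le by (blast intro: order_trans)
      moreover have "functional_face (dominated i) (dominated q)"
        using functional_face_INT[of C dominated, OF face False] inf(3) by simp
      ultimately have "i \<in> A" using inf(1) by (simp add: A_def)
      with inf(2) show ?thesis by blast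
    qed
  qed
  then obtain m where m: "m \<in> A" and min: "\<And>a. a \<in> A \<Longrightarrow> a \<le> m \<Longrightarrow> a = m" by blast
  have sub: "sublinear m" and le: "m \<le> q" and face: "functional_face (dominated m) (dominated q)"
    using m by (auto simp: A_def)
  have "m (- y) = - m y" for y
  proof -
    \<comment> \<open>The ray through \<open>(y, m y)\<close> encodes the constraint
      \<open>m y \<le> u y\<close>.\<close>
    define M where "M = (\<lambda>s. (s *\<^sub>R y, s * m y)) ` {0..}"
    obtain m' where m': "sublinear m'" "m' \<le> m"
      "dominated m' = {u \<in> dominated m. \<forall>(x, r)\<in>M. r \<le> u x}"
      "\<And>x r. (x, r) \<in> M \<Longrightarrow> m' (- x) \<le> - r"
    proof (rule sublinear_cone_constraint[OF sub, of M])
      show "(0, 0) \<in> M" unfolding M_def by (rule image_eqI[of _ _ 0]) auto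
      show "(x + x', r + r') \<in> M" if "(x, r) \<in> M" "(x', r') \<in> M" for x r x' r'
        using that unfolding M_def
        by (auto simp: algebra_simps intro!: image_eqI[of _ _ "_ + _"])
      show "(c *\<^sub>R x, c * r) \<in> M" if "c > 0" "(x, r) \<in> M" for c x r
        using that unfolding M_def by (auto intro!: image_eqI[of _ _ "_ * _"])
      show "r \<le> m x" if "(x, r) \<in> M" for x r
        using that sublinear_scale[OF sub] unfolding M_def by auto
    qed blast
    have yM: "(y, m y) \<in> M" unfolding M_def by (rule image_eqI[of _ _ 1]) auto
    have eq: "u y = m y" if "u \<in> dominated m'" for u
    proof (rule antisym)
      have u: "u \<in> dominated m" "\<forall>(x, r)\<in>M. r \<le> u x" using that m'(3) by blast+
      then show "u y \<le> m y" by (simp add: dominated_def)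
      show "m y \<le> u y" using u(2) yM by blast
    qed
    have iff: "u \<in> dominated m' \<longleftrightarrow> u \<in> dominated m \<and> u y = m y" for u
    proof
      assume "u \<in> dominated m \<and> u y = m y"
      then show "u \<in> dominated m'"
        unfolding m'(3) M_def by (auto simp: dominated_def linear_scale)
    qed (use eq m'(3) in blast)
    have "functional_face (dominated m') (dominated m)"
      unfolding functional_face_def
    proof (intro conjI ballI allI impI)
      show "dominated m' \<subseteq> dominated m" using iff by blast
      fix u v s
      assume uv: "u \<in> dominated m" "v \<in> dominated m"
        and s: "0 < s \<and> s < 1 \<and> (\<lambda>x. (1 - s) * u x + s * v x) \<in> dominated m'"
      have u: "u y \<le> m y" and v: "v y \<le> m y" using uv by (auto simp: dominated_def)
      have "(1 - s) * u y + s * v y = m y" using s iff[of "\<lambda>x. (1 - s) * u x + s * v x"] by simp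
      \<comment> \<open>A vanishing sum of nonnegative terms: both functionals attain the bound
        \<open>m y\<close>.\<close>
      then have "(1 - s) * (m y - u y) + s * (m y - v y) = 0" by (simp add: algebra_simps)
      then have "(1 - s) * (m y - u y) = 0 \<and> s * (m y - v y) = 0"
        using s u v by (subst (asm) add_nonneg_eq_0_iff) auto
      then have "u y = m y" "v y = m y" using s by auto
      then show "u \<in> dominated m'" "v \<in> dominated m'" using uv iff by auto
    qed
    then have "m' \<in> A"
      using face m'(1,2) le by (auto simp: A_def intro: functional_face_trans order_trans)
    then have "m' = m" using min m'(2) by blast
    then have "m (- y) \<le> - m y" using m'(4)[OF yM] by simp
    then show ?thesis using sublinear_minus_le[OF sub, of "- y"] sublinear_minus_le[OF sub, of y] by simp
  qed
  then have lin: "linear m" by (rule linear_of_odd_sublinear[OF sub])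
  have "u = m" if "u \<in> dominated m" for u
  proof
    fix x
    have "u x \<le> m x" "u (- x) \<le> m (- x)" "linear u" using that by (auto simp: dominated_def)
    then show "u x = m x" using lin by (simp add: linear_neg)
  qed
  then have "dominated m = {m}" using lin by (auto simp: dominated_def)
  then show ?thesis using that face by simp
qed

section \<open>Real and complex scalars\<close>

text \<open>
  In the real case \<open>j = 0\<close> rather than an imaginary unit, so that the formulas below cover
  both scalar fields.
\<close>

locale complex_embedding =
  fixes J :: "'k::real_or_complex \<Rightarrow> complex" and j :: 'k
  assumes linear_J: "linear J"
    and J_mult: "J (x * y) = J x * J y"
    and norm_J: "norm (J z) = norm z"
    and j_square: "j = 0 \<or> j * j = - 1"
    and decomposition: "z = of_real (Re (J z)) - of_real (Re (J (j * z))) * j"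
begin

lemma inj_J: "inj J"
proof (rule injI)
  fix x y assume "J x = J y"
  then have "J (x - y) = 0" by (simp add: linear_diff[OF linear_J])
  then show "x = y" using norm_J[of "x - y"] by simp
qed

lemma J_1: "J 1 = 1"
proof -
  have "J 1 * J 1 = J 1" using J_mult[of 1 1] by simp
  moreover have "J 1 \<noteq> 0" using norm_J[of 1] by auto
  ultimately show ?thesis by simp
qed

lemma J_of_real: "J (of_real r) = of_real r"
  using linear_scale[OF linear_J, of r 1] by (simp add: J_1 of_real_def)

text \<open>A complex square root of -1 with nonzero real part would have imaginary part 0 and hence
  a nonnegative square.\<close>

lemma Re_J_j: "Re (J j) = 0"
proof -
  have "J j = 0 \<or> J j * J j = - 1"
    using j_square J_mult[of j j] J_of_real[of "-1"] J_of_real[of 0] by auto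
  then show ?thesis
  proof
    assume "J j * J j = - 1"
    then have "(Re (J j))\<^sup>2 - (Im (J j))\<^sup>2 = - 1" "Re (J j) * Im (J j) = 0"
      by (auto simp: complex_eq_iff power2_eq_square)
    moreover have "(Re (J j))\<^sup>2 \<noteq> - 1" using zero_le_power2[of "Re (J j)"] by linarith
    ultimately show ?thesis by auto
  qed simp
qed

text \<open>By \<open>decomposition\<close>, the real parts for \<open>c = 1\<close> and
  \<open>c = j\<close> determine the scalar.\<close>

lemma eqI_Re_J_mult:
  assumes "\<And>c. Re (J (c * x)) = Re (J (c * y))"
  shows "x = y"
  using decomposition[of x] decomposition[of y] assms[of 1] assms[of j] by simp

lemma eq_of_real_norm:
  assumes "norm z \<le> r" "Re (J z) = r"
  shows "z = of_real r"
proof -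
  have "cmod (J z) = Re (J z)"
    using assms complex_Re_le_cmod[of "J z"] norm_J[of z] by simp
  then have "(Im (J z))\<^sup>2 = 0" using cmod_power2[of "J z"] by simp
  then have "J z = of_real r" using assms(2) by (simp add: complex_eq_iff)
  then show ?thesis using inj_J J_of_real[of r] by (metis injD)
qed

text \<open>The conjugate of a nonzero \<open>J z\<close> is its squared modulus divided by
  \<open>J z\<close>, which stays in the range of \<open>J\<close>. This turns inner products in the
  plane into real parts of scalar products.\<close>

lemma exists_cnj_J: "\<exists>c. J c = cnj (J z)"
proof (cases "z = 0")
  case True
  then show ?thesis by (intro exI[of _ 0]) (simp add: linear_0[OF linear_J])
next
  case False
  define c where "c = of_real ((norm z)\<^sup>2) / z"
  have "J c * J z = of_real ((norm z)\<^sup>2)"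
    using False by (simp add: c_def flip: J_mult J_of_real)
  also have "\<dots> = cnj (J z) * J z"
    by (simp only: norm_J[symmetric] complex_norm_square mult.commute)
  finally show ?thesis using False norm_J[of z] by auto
qed

lemma closed_range_J: "closed (range J)"
  by (intro closed_subspace linear_subspace_image linear_J subspace_UNIV)

end

lemma exists_unit_scalar: "\<exists>c::'k::real_normed_field. norm c = 1 \<and> c * z = of_real (norm z)"
proof (cases "z = 0")
  case False
  then show ?thesis
    by (intro exI[of _ "of_real (norm z) / z"]) (simp add: norm_divide)
qed (auto intro: exI[of _ 1])

text \<open>In the real case \<open>J\<close> takes the real coordinate. In the complex case
  \<open>T\<close> is an injective ring homomorphism from the complex numbers onto
  \<open>'k\<close>, and \<open>J\<close> is its inverse.\<close>

lemma complex_embedding_exists: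
  obtains J :: "'k::real_or_complex \<Rightarrow> complex" and j where "complex_embedding J j"
  using real_or_complex[where 'a = 'k]
proof (elim disjE exE conjE)
  assume "\<forall>z::'k. \<exists>a. z = a *\<^sub>R 1"
  then have r: "\<exists>a. z = of_real a" for z :: 'k by (simp add: of_real_def)
  define R where "R z = (SOME a. z = (of_real a :: 'k))" for z
  have R: "of_real (R z) = z" for z
    unfolding R_def using someI_ex[OF r[of z]] by simp
  have R_of_real: "R (of_real a) = a" for a
    using R[of "of_real a"] by (simp only: of_real_eq_iff)
  have "complex_embedding (\<lambda>z. complex_of_real (R z)) 0"
  proof
    fix x y z :: 'k and c :: real
    obtain a b where [simp]: "x = of_real a" "y = of_real b" using r by blast
    show "complex_of_real (R (x + y)) = of_real (R x) + of_real (R y)"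
      using R_of_real[of "a + b"] by (simp add: R_of_real)
    show "complex_of_real (R (x * y)) = of_real (R x) * of_real (R y)"
      using R_of_real[of "a * b"] by (simp add: R_of_real)
    show "complex_of_real (R (c *\<^sub>R x)) = c *\<^sub>R of_real (R x)"
      using R_of_real[of "c * a"] by (simp add: R_of_real scaleR_conv_of_real)
    show "cmod (complex_of_real (R z)) = norm z"
      using norm_of_real[of "R z", where 'a = 'k] by (simp add: R)
    show "z = of_real (Re (of_real (R z))) - of_real (Re (of_real (R (0 * z)))) * 0"
      by (simp add: R)
  qed simp
  then show ?thesis by (rule that)
next
  fix i :: 'k
  assume i: "i * i = - 1"
    and "\<forall>z. \<exists>a b. z = a *\<^sub>R 1 + b *\<^sub>R i \<and> norm z = sqrt (a\<^sup>2 + b\<^sup>2)"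
  then have ex: "\<exists>a b. z = of_real a + of_real b * i \<and> norm z = sqrt (a\<^sup>2 + b\<^sup>2)" for z
    by (simp add: scaleR_conv_of_real)
  define T where "T w = of_real (Re w) + of_real (Im w) * i" for w
  \<comment> \<open>Each \<open>w\<close> is chosen together with its modulus, which makes
    \<open>J\<close> isometric.\<close>
  have "\<exists>w. z = T w \<and> norm z = cmod w" for z
  proof -
    obtain a b where "z = of_real a + of_real b * i" "norm z = sqrt (a\<^sup>2 + b\<^sup>2)" using ex by blast
    then show ?thesis by (intro exI[of _ "Complex a b"]) (simp add: T_def cmod_def)
  qed
  then obtain J where TJ: "T (J z) = z" and norm: "norm z = cmod (J z)" for z by metis
  have T_zero: "w = 0" if "T w = 0" for w
  proof -
    \<comment> \<open>Squaring this identity equates a nonnegative real number with a nonpositive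
      one.\<close>
    have eq: "of_real (Im w) * i = - of_real (Re w)"
      using that by (simp add: T_def eq_neg_iff_add_eq_0 add.commute)
    then have "(of_real (Im w) * i) * (of_real (Im w) * i) = (of_real ((Re w)\<^sup>2) :: 'k)"
      by (simp add: power2_eq_square)
    moreover have "(of_real (Im w) * i) * (of_real (Im w) * i) = (of_real (Im w) * of_real (Im w)) * (i * i)"
      by (simp add: mult_ac)
    ultimately have "(of_real ((Re w)\<^sup>2) :: 'k) = of_real (- ((Im w)\<^sup>2))"
      by (simp add: i power2_eq_square)
    then have "(Re w)\<^sup>2 = - ((Im w)\<^sup>2)" by (simp only: of_real_eq_iff)
    then show ?thesis by (simp add: complex_eq_iff sum_power2_eq_zero_iff eq_neg_iff_add_eq_0)
  qed
  have T_diff: "T (v - w) = T v - T w" for v w by (simp add: T_def algebra_simps)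
  have T_add: "T (v + w) = T v + T w" for v w by (simp add: T_def algebra_simps)
  have T_scaleR: "T (c *\<^sub>R w) = c *\<^sub>R T w" for c w
    by (simp add: T_def scaleR_conv_of_real algebra_simps)
  have T_inj: "v = w" if "T v = T w" for v w
    using T_zero[of "v - w"] that by (simp add: T_diff)
  have T_mult: "T (v * w) = T v * T w" for v w
  proof -
    have "T v * T w = of_real (Re v) * of_real (Re w) + of_real (Re v) * of_real (Im w) * i
        + of_real (Im v) * of_real (Re w) * i + of_real (Im v) * of_real (Im w) * (i * i)"
      by (simp add: T_def algebra_simps)
    then show ?thesis by (simp add: T_def i algebra_simps)
  qed
  have T_i: "T \<i> = i" by (simp add: T_def)
  have J_mult: "J (x * y) = J x * J y" for x y by (rule T_inj) (simp add: TJ T_mult)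
  have J_i: "J i = \<i>" by (rule T_inj) (simp add: TJ T_i)
  have "complex_embedding J i"
  proof
    fix x y z :: 'k and c :: real
    show "J (x + y) = J x + J y"
      by (rule T_inj) (simp only: TJ T_add)
    show "J (c *\<^sub>R x) = c *\<^sub>R J x"
      by (rule T_inj) (simp only: TJ T_scaleR)
    show "J (x * y) = J x * J y" by (rule J_mult)
    show "cmod (J z) = norm z" by (simp add: norm)
    show "i = 0 \<or> i * i = - 1" by (simp add: i)
    show "z = of_real (Re (J z)) - of_real (Re (J (i * z))) * i"
      using TJ[of z] by (simp add: J_mult J_i T_def)
  qed
  then show ?thesis by (rule that)
qed

section \<open>Faces of the dual ball\<close>

locale normed_over_embedding = normed_over smul + complex_embedding J j
  for smul :: "'k::real_or_complex \<Rightarrow> 'y::real_normed_vector \<Rightarrow> 'y"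
    and J :: "'k \<Rightarrow> complex" and j :: 'k
begin

section \<open>Scalar functionals and their real parts\<close>

lemma linear_smul: "linear (smul c)"
  by (rule bounded_linear.linear[OF bounded_linear_scale])

lemma smul_scaleR: "smul (r *\<^sub>R c) y = r *\<^sub>R smul c y"
  by (simp only: scaleR_conv_of_real scale_of_real[symmetric] scale_scale)

lemma dual_apply_le:
  assumes "\<phi> \<in> dual_ball smul"
  shows "norm (blinfun_apply \<phi> y) \<le> norm y"
proof -
  have "norm (blinfun_apply \<phi> y) \<le> norm \<phi> * norm y" by (rule norm_blinfun)
  also have "\<dots> \<le> 1 * norm y" using assms by (intro mult_right_mono) (auto simp: dual_ball_def)
  finally show ?thesis by simp
qed

lemma dual_apply_smul: "\<phi> \<in> dual_ball smul \<Longrightarrow> blinfun_apply \<phi> (smul c y) = c * blinfun_apply \<phi> y"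
  by (simp add: dual_ball_def dual_def)

lemma linear_Re_J_blinfun: "linear (\<lambda>y. Re (J (blinfun_apply \<phi> y)))"
  by (rule linearI) (simp_all add: blinfun.add_right blinfun.scaleR_right
      linear_add[OF linear_J] linear_scale[OF linear_J])

lemma Re_J_dual_dominated:
  assumes "\<phi> \<in> dual_ball smul"
  shows "(\<lambda>y. Re (J (blinfun_apply \<phi> y))) \<in> dominated norm"
proof -
  have "Re (J (blinfun_apply \<phi> y)) \<le> norm y" for y
    using complex_Re_le_cmod[of "J (blinfun_apply \<phi> y)"] dual_apply_le[OF assms, of y]
    by (simp add: norm_J)
  then show ?thesis by (simp add: dominated_def linear_Re_J_blinfun)
qed

lemma dual_eqI:
  assumes "\<phi> \<in> dual_ball smul" "\<psi> \<in> dual_ball smul"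
    and eq: "\<And>y. Re (J (blinfun_apply \<phi> y)) = Re (J (blinfun_apply \<psi> y))"
  shows "\<phi> = \<psi>"
proof (rule blinfun_eqI, rule eqI_Re_J_mult)
  fix y c
  show "Re (J (c * blinfun_apply \<phi> y)) = Re (J (c * blinfun_apply \<psi> y))"
    using eq[of "smul c y"] assms(1,2) by (simp add: dual_apply_smul)
qed

text \<open>The complexification of Bohnenblust and Sobczyk: a scalar functional with real part
  \<open>u\<close> is \<open>u y - u (smul j y) * j\<close>. For \<open>j = 0\<close> it reduces to
  \<open>u\<close>.\<close>

lemma dual_ball_of_dominated:
  assumes u: "u \<in> dominated norm"
  obtains \<phi> where "\<phi> \<in> dual_ball smul" "\<And>y. Re (J (blinfun_apply \<phi> y)) = u y"
proof -
  have lin: "linear u" and le: "u y \<le> norm y" for y using u by (auto simp: dominated_def)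
  define F where "F y = of_real (u y) - of_real (u (smul j y)) * j" for y
  have Re_F: "Re (J (F y)) = u y" for y
    by (simp add: F_def linear_diff[OF linear_J] J_of_real J_mult Re_J_j)
  have F_add: "F (x + y) = F x + F y" for x y
    by (simp add: F_def scale_right_distrib linear_add[OF lin] algebra_simps)
  have F_scaleR: "F (r *\<^sub>R y) = r *\<^sub>R F y" for r y
    by (simp add: F_def linear_scale[OF lin] linear_scale[OF linear_smul] scaleR_conv_of_real algebra_simps)
  have F_j: "F (smul j y) = j * F y" for y
    using j_square
  proof
    assume "j = 0"
    then show ?thesis using linear_0[OF lin] by (simp add: F_def)
  next
    assume j: "j * j = - 1"
    have "smul j (smul j y) = smul (of_real (- 1)) y" by (simp add: scale_scale j)
    also have "\<dots> = - y" by (simp only: scale_of_real) simp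
    finally have "F (smul j y) = of_real (u (smul j y)) + of_real (u y) * j"
      by (simp add: F_def linear_neg[OF lin])
    also have "\<dots> = j * of_real (u y) - of_real (u (smul j y)) * (j * j)"
      by (simp add: j)
    also have "\<dots> = j * F y" by (simp add: F_def algebra_simps)
    finally show ?thesis .
  qed
  have F_smul: "F (smul c y) = c * F y" for c y
  proof -
    define a b where "a = Re (J c)" and "b = - Re (J (j * c))"
    have c: "c = of_real a + of_real b * j"
      using decomposition[of c] by (simp add: a_def b_def)
    have "smul c y = a *\<^sub>R y + b *\<^sub>R smul j y"
      unfolding c scale_left_distrib scale_scale[symmetric] scale_of_real by simp
    then have "F (smul c y) = of_real a * F y + of_real b * (j * F y)"
      by (simp add: F_add F_scaleR F_j scaleR_conv_of_real)
    then show ?thesis by (simp add: c algebra_simps)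
  qed
  have norm_F: "norm (F y) \<le> norm y" for y
  proof -
    \<comment> \<open>A unimodular factor turns \<open>F y\<close> into its modulus, so the bound on
      the real part \<open>u\<close> suffices.\<close>
    obtain c where c: "norm c = 1" "c * F y = of_real (norm (F y))" using exists_unit_scalar by blast
    have "norm (F y) = Re (J (F (smul c y)))" by (simp add: F_smul c J_of_real)
    also have "\<dots> \<le> norm (smul c y)" by (simp add: Re_F le)
    finally show ?thesis by (simp add: norm_scale c)
  qed
  have "bounded_linear F"
    by (rule bounded_linear_intro[where K = 1]) (simp_all add: F_add F_scaleR norm_F)
  then have apply_F: "blinfun_apply (Blinfun F) = F" by (rule bounded_linear_Blinfun_apply)
  have "norm (Blinfun F) \<le> 1" by (rule norm_blinfun_bound) (simp_all add: apply_F norm_F)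
  then have "Blinfun F \<in> dual_ball smul" by (simp add: dual_ball_def dual_def apply_F F_smul)
  then show ?thesis using that apply_F Re_F by simp
qed

text \<open>Taking real parts respects convex combinations and is injective on the dual ball by
  \<open>dual_eqI\<close>, so extremality passes from \<open>u\<close> to
  \<open>\<phi>\<close>.\<close>

lemma extreme_point_of_dual_ball:
  assumes face: "functional_face {u} (dominated norm)"
    and \<phi>: "\<phi> \<in> dual_ball smul" "\<And>y. Re (J (blinfun_apply \<phi> y)) = u y"
  shows "\<phi> extreme_point_of dual_ball smul"
  unfolding extreme_point_of_def
proof (intro conjI ballI notI)
  fix a b assume a: "a \<in> dual_ball smul" and b: "b \<in> dual_ball smul" and "\<phi> \<in> open_segment a b"
  then obtain s where ne: "a \<noteq> b" and s: "0 < s" "s < 1" "\<phi> = (1 - s) *\<^sub>R a + s *\<^sub>R b"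
    by (auto simp: in_segment)
  have "u y = (1 - s) * Re (J (blinfun_apply a y)) + s * Re (J (blinfun_apply b y))" for y
    unfolding \<phi>(2)[symmetric] s(3)
    by (simp add: blinfun.add_left blinfun.scaleR_left linear_add[OF linear_J] linear_scale[OF linear_J])
  then have comb: "(\<lambda>y. (1 - s) * Re (J (blinfun_apply a y)) + s * Re (J (blinfun_apply b y))) \<in> {u}"
    by (simp add: fun_eq_iff)
  have "(\<lambda>y. Re (J (blinfun_apply a y))) = u \<and> (\<lambda>y. Re (J (blinfun_apply b y))) = u"
    using functional_faceD[OF face Re_J_dual_dominated[OF a] Re_J_dual_dominated[OF b] s(1,2) comb]
    by blast
  then have "a = b" by (intro dual_eqI[OF a b]) (simp add: fun_eq_iff)
  with ne show False by simp
qed (rule \<phi>)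

text \<open>
  For \<open>norm x \<le> n\<close> these are the values at \<open>y\<close> of the functionals in the dual ball that
  take the value \<open>n\<close> at \<open>x\<close>; \<open>c = 0\<close> forces the set to be empty if \<open>norm x < n\<close>.
\<close>

definition face_values :: "'y \<Rightarrow> 'y \<Rightarrow> real \<Rightarrow> 'k set"
  where "face_values x y n = {z. \<forall>s\<ge>0. \<forall>c. Re (J (c * z)) \<le> norm (smul c y + s *\<^sub>R x) - s * n}"

section \<open>The values at a vector of the functionals norming another one\<close>

lemma apply_in_face_values:
  assumes \<phi>: "\<phi> \<in> dual_ball smul" "blinfun_apply \<phi> x = of_real n"
  shows "blinfun_apply \<phi> y \<in> face_values x y n"
  unfolding face_values_def
proof (intro CollectI allI impI)
  fix s :: real and c
  have "Re (J (blinfun_apply \<phi> (smul c y + s *\<^sub>R x))) \<le> norm (smul c y + s *\<^sub>R x)"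
    using Re_J_dual_dominated[OF \<phi>(1)] by (simp add: dominated_def)
  then show "Re (J (c * blinfun_apply \<phi> y)) \<le> norm (smul c y + s *\<^sub>R x) - s * n"
    by (simp add: blinfun.add_right blinfun.scaleR_right dual_apply_smul \<phi> linear_add[OF linear_J]
        linear_scale[OF linear_J] J_of_real)
qed

lemma norm_face_values_le:
  assumes "z \<in> face_values x y n"
  shows "norm z \<le> norm y"
proof -
  obtain c where c: "norm c = 1" "c * z = of_real (norm z)" using exists_unit_scalar by blast
  have "Re (J (c * z)) \<le> norm (smul c y + 0 *\<^sub>R x) - 0 * n"
    using assms unfolding face_values_def by blast
  then show ?thesis by (simp add: c J_of_real norm_scale)
qed

text \<open>In terms of \<open>w = J z\<close> the conditions are closed inequalities in the plane;
  both compactness arguments start from this form.\<close>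

lemma J_image_face_values:
  "J ` face_values x y n =
    {w \<in> range J. \<forall>s\<ge>0. \<forall>c. Re (J c * w) \<le> norm (smul c y + s *\<^sub>R x) - s * n}"
  by (auto simp: face_values_def J_mult)

lemma compact_J_face_values: "compact (J ` face_values x y n)"
  unfolding compact_eq_bounded_closed
proof
  show "bounded (J ` face_values x y n)"
    using norm_face_values_le by (auto simp: bounded_iff norm_J intro!: exI[of _ "norm y"])
  show "closed (J ` face_values x y n)"
    unfolding J_image_face_values
    by (intro closed_Collect_conj closed_Collect_all closed_Collect_imp closed_Collect_le
        open_Collect_const continuous_intros) (simp add: closed_range_J)
qed

lemma convex_J_face_values: "convex (J ` face_values x y n)"
proof (rule convex_linear_image[OF linear_J], rule convexI)
  fix z w and a b :: real
  assume z: "z \<in> face_values x y n" and w: "w \<in> face_values x y n"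
    and ab: "0 \<le> a" "0 \<le> b" "a + b = 1"
  show "a *\<^sub>R z + b *\<^sub>R w \<in> face_values x y n"
    unfolding face_values_def
  proof (intro CollectI allI impI)
    fix s :: real and c assume "s \<ge> 0"
    let ?r = "norm (smul c y + s *\<^sub>R x) - s * n"
    have "Re (J (c * z)) \<le> ?r" "Re (J (c * w)) \<le> ?r"
      using z w \<open>s \<ge> 0\<close> unfolding face_values_def by blast+
    then have "a * Re (J (c * z)) + b * Re (J (c * w)) \<le> ?r"
      by (rule convex_bound_le) (use ab in simp_all)
    then show "Re (J (c * (a *\<^sub>R z + b *\<^sub>R w))) \<le> ?r"
      by (simp add: ring_distribs linear_add[OF linear_J] linear_scale[OF linear_J])
  qed
qed

text \<open>The chain \<open>n \<le> u x \<le> norm x \<le> n\<close> consists of equalities, and a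
  scalar whose modulus is at most its real part is real.\<close>

lemma dominated_face_value:
  assumes x: "norm x \<le> n" and u: "u \<in> dominated norm" "n \<le> u x"
  obtains \<phi> where "\<phi> \<in> dual_ball smul" "\<And>y. Re (J (blinfun_apply \<phi> y)) = u y"
    "blinfun_apply \<phi> x = of_real n"
proof -
  obtain \<phi> where \<phi>: "\<phi> \<in> dual_ball smul" "\<And>y. Re (J (blinfun_apply \<phi> y)) = u y"
    using dual_ball_of_dominated[OF u(1)] by blast
  have "u x = n" using u x by (auto simp: dominated_def intro: antisym order_trans)
  then have "blinfun_apply \<phi> x = of_real n"
    using dual_apply_le[OF \<phi>(1), of x] x \<phi>(2)[of x] by (intro eq_of_real_norm) auto
  with \<phi> show ?thesis using that by blast
qed

text \<open>Since \<open>n\<close> is the largest possible value at \<open>x\<close> and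
  \<open>z\<close> is extreme among the resulting values at \<open>y\<close>, the functionals with
  these two values form a face of the dual ball. An extreme point of the face is extreme in the
  ball.\<close>

lemma extreme_face_value:
  assumes x: "norm x \<le> n" and ext: "J z extreme_point_of J ` face_values x y n"
  obtains \<psi> where "\<psi> extreme_point_of dual_ball smul"
    "blinfun_apply \<psi> x = of_real n" "blinfun_apply \<psi> y = z"
proof -
  have z: "z \<in> face_values x y n"
    using ext inj_J by (auto simp: extreme_point_of_def inj_image_mem_iff)
  \<comment> \<open>The constraints for \<open>c\<close> and \<open>- c\<close> combine to an
    equality at \<open>y\<close>; at \<open>x\<close> a lower bound is enough because
    \<open>norm x \<le> n\<close>. Consistency with \<open>norm\<close> is the membership of
    \<open>z\<close> in \<open>face_values x y n\<close>.\<close>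
  define M where "M = {(smul c y + s *\<^sub>R x, Re (J (c * z)) + s * n) | c s. s \<ge> 0}"
  have MI: "(smul c y + s *\<^sub>R x, Re (J (c * z)) + s * n) \<in> M" if "s \<ge> 0" for c s
    using that unfolding M_def by blast
  obtain q where q: "sublinear q" and dom: "dominated q = {u \<in> dominated norm. \<forall>(m, r)\<in>M. r \<le> u m}"
  proof (rule sublinear_cone_constraint[OF sublinear_norm, of M])
    show "(0, 0) \<in> M" using MI[of 0 0] by (simp add: linear_0[OF linear_J])
  next
    fix m r m' r' assume "(m, r) \<in> M" "(m', r') \<in> M"
    then obtain c s c' s' where *: "m = smul c y + s *\<^sub>R x" "r = Re (J (c * z)) + s * n" "s \<ge> 0"
      "m' = smul c' y + s' *\<^sub>R x" "r' = Re (J (c' * z)) + s' * n" "s' \<ge> 0"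
      unfolding M_def by blast
    then show "(m + m', r + r') \<in> M"
      using MI[of "s + s'" "c + c'"]
      by (simp add: scale_left_distrib ring_distribs linear_add[OF linear_J] scaleR_left_distrib add_ac)
  next
    fix a :: real and m r assume a: "a > 0" and "(m, r) \<in> M"
    then obtain c s where *: "m = smul c y + s *\<^sub>R x" "r = Re (J (c * z)) + s * n" "s \<ge> 0"
      unfolding M_def by blast
    then show "(a *\<^sub>R m, a * r) \<in> M"
      using MI[of "a * s" "a *\<^sub>R c"] a
      by (simp add: smul_scaleR scaleR_right_distrib linear_scale[OF linear_J] ring_distribs mult_ac)
  next
    fix m r assume "(m, r) \<in> M"
    then show "r \<le> norm m" using z unfolding M_def face_values_def by (auto simp: le_diff_eq)
  qed blast
  have lower: "Re (J (c * z)) \<le> u (smul c y)" and lower_x: "n \<le> u x" if "u \<in> dominated q" for u c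
    using that MI[of 0 c] MI[of 1 0] unfolding dom by (auto simp: linear_0[OF linear_J])
  have eq: "u (smul c y) = Re (J (c * z))" if "u \<in> dominated q" for u c
  proof -
    have lin: "linear u" using that by (simp add: dominated_def)
    have "u (smul (- c) y) = - u (smul c y)" using linear_neg[OF lin] by simp
    then show ?thesis
      using lower[OF that, of c] lower[OF that, of "- c"] by (simp add: linear_neg[OF linear_J])
  qed
  have "functional_face (dominated q) (dominated norm)"
    unfolding functional_face_def
  proof (intro conjI ballI allI impI)
    show "dominated q \<subseteq> dominated norm" unfolding dom by blast
    fix u v s
    assume u: "u \<in> dominated norm" and v: "v \<in> dominated norm"
      and "0 < s \<and> s < 1 \<and> (\<lambda>x. (1 - s) * u x + s * v x) \<in> dominated q"
    then have s: "0 < s" "s < 1" and comb: "(\<lambda>x. (1 - s) * u x + s * v x) \<in> dominated q" by blast+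
    have ux: "u x \<le> n" and vx: "v x \<le> n" using u v x by (auto simp: dominated_def intro: order_trans)
    have "n \<le> (1 - s) * u x + s * v x" using lower_x[OF comb] .
    then have "(1 - s) * (n - u x) + s * (n - v x) \<le> 0" by (simp add: algebra_simps)
    moreover have "(1 - s) * (n - u x) \<ge> 0" "s * (n - v x) \<ge> 0" using s ux vx by simp_all
    ultimately have "(1 - s) * (n - u x) = 0" "s * (n - v x) = 0" by linarith+
    then have ux: "n \<le> u x" "u x = n" and vx: "n \<le> v x" "v x = n" using s by auto
    obtain \<phi> where \<phi>: "\<phi> \<in> dual_ball smul" "\<And>y. Re (J (blinfun_apply \<phi> y)) = u y" "blinfun_apply \<phi> x = of_real n"
      using dominated_face_value[OF x u ux(1)] by blast
    obtain \<psi> where \<psi>: "\<psi> \<in> dual_ball smul" "\<And>y. Re (J (blinfun_apply \<psi> y)) = v y" "blinfun_apply \<psi> x = of_real n"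
      using dominated_face_value[OF x v vx(1)] by blast
    let ?a = "blinfun_apply \<phi> y" and ?b = "blinfun_apply \<psi> y"
    \<comment> \<open>The scalar functionals with real parts \<open>u\<close> and \<open>v\<close>
      have face values at \<open>y\<close> of which \<open>z\<close> is a convex combination, so
      extremality makes both equal to \<open>z\<close>.\<close>
    have "z = (1 - s) *\<^sub>R ?a + s *\<^sub>R ?b"
    proof (rule eqI_Re_J_mult)
      fix c
      have "Re (J (c * z)) = (1 - s) * u (smul c y) + s * v (smul c y)" using eq[OF comb] by simp
      also have "\<dots> = (1 - s) * Re (J (c * ?a)) + s * Re (J (c * ?b))"
        by (simp only: \<phi>(2)[symmetric] \<psi>(2)[symmetric] dual_apply_smul[OF \<phi>(1)] dual_apply_smul[OF \<psi>(1)])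
      finally show "Re (J (c * z)) = Re (J (c * ((1 - s) *\<^sub>R ?a + s *\<^sub>R ?b)))"
        by (simp add: ring_distribs linear_add[OF linear_J] linear_scale[OF linear_J])
    qed
    then have Jz: "J z = (1 - s) *\<^sub>R J ?a + s *\<^sub>R J ?b"
      by (simp add: linear_add[OF linear_J] linear_scale[OF linear_J])
    have "J ?a = J ?b"
    proof (rule ccontr)
      assume "J ?a \<noteq> J ?b"
      then have "J z \<in> open_segment (J ?a) (J ?b)" using s Jz by (auto simp: in_segment)
      moreover have "J ?a \<in> J ` face_values x y n" "J ?b \<in> J ` face_values x y n"
        using apply_in_face_values \<phi> \<psi> by blast+
      ultimately show False using ext by (auto simp: extreme_point_of_def)
    qed
    then have "J ?a = J z" "J ?b = J z" unfolding Jz by (simp_all flip: scaleR_left_distrib)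
    then have ab: "?a = z" "?b = z" using inj_J by (auto dest: injD)
    \<comment> \<open>Conversely, the values \<open>n\<close> at \<open>x\<close> and
      \<open>z\<close> at \<open>y\<close> turn every constraint in \<open>M\<close> into an
      equality.\<close>
    have mem: "w \<in> dominated q" if w: "w \<in> dominated norm" "w x = n" "\<theta> \<in> dual_ball smul"
        "\<And>y. Re (J (blinfun_apply \<theta> y)) = w y" "blinfun_apply \<theta> y = z" for w \<theta>
    proof -
      have lin: "linear w" using w(1) by (simp add: dominated_def)
      have "w (smul c y + s *\<^sub>R x) = Re (J (c * z)) + s * n" for c s
      proof -
        have "w (smul c y) = Re (J (c * z))" by (simp only: w(4)[symmetric] dual_apply_smul[OF w(3)] w(5))
        then show ?thesis by (simp add: linear_add[OF lin] linear_scale[OF lin] w(2))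
      qed
      then show ?thesis using w(1) unfolding dom M_def by auto
    qed
    show "u \<in> dominated q" by (rule mem[OF u ux(2) \<phi>(1,2) ab(1)])
    show "v \<in> dominated q" by (rule mem[OF v vx(2) \<psi>(1,2) ab(2)])
  qed
  moreover obtain u where u: "functional_face {u} (dominated q)"
    using extreme_dominated_exists[OF q] by blast
  ultimately have face: "functional_face {u} (dominated norm)" using functional_face_trans by blast
  have uq: "u \<in> dominated q" using u by (simp add: functional_face_def)
  then have u_norm: "u \<in> dominated norm" unfolding dom by blast
  obtain \<psi> where \<psi>: "\<psi> \<in> dual_ball smul" "\<And>y. Re (J (blinfun_apply \<psi> y)) = u y"
    "blinfun_apply \<psi> x = of_real n"
    using dominated_face_value[OF x u_norm lower_x[OF uq]] by blast
  have "blinfun_apply \<psi> y = z"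
    by (rule eqI_Re_J_mult) (simp only: dual_apply_smul[OF \<psi>(1), symmetric] \<psi>(2) eq[OF uq])
  with \<psi>(3) extreme_point_of_dual_ball[OF face \<psi>(1,2)] that show ?thesis by blast
qed

lemma face_values_subset_convex_hull:
  assumes x: "norm x \<le> n"
  shows "face_values x y n \<subseteq> convex hull
    {blinfun_apply \<psi> y | \<psi>. \<psi> extreme_point_of dual_ball smul \<and> blinfun_apply \<psi> x = of_real n}"
    (is "_ \<subseteq> convex hull ?E")
proof
  fix z assume "z \<in> face_values x y n"
  then have "J z \<in> convex hull {w. w extreme_point_of J ` face_values x y n}"
    using Krein_Milman_Minkowski[OF compact_J_face_values convex_J_face_values, of x y n] by blast
  also have "\<dots> \<subseteq> convex hull (J ` ?E)"
  proof (rule hull_mono, safe)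
    fix w assume w: "w extreme_point_of J ` face_values x y n"
    then obtain z where "w = J z" by (auto simp: extreme_point_of_def)
    with w show "w \<in> J ` ?E" using extreme_face_value[OF x, of z y] by blast
  qed
  also have "\<dots> = J ` (convex hull ?E)" by (rule convex_hull_linear_image[OF linear_J, symmetric])
  finally show "z \<in> convex hull ?E" using inj_J by (simp add: inj_image_mem_iff)
qed

text \<open>A Hahn-Banach argument: the norm inequalities make the cone spanned by the constraints
  \<open>n \<le> u x\<close> and \<open>0 \<le> u (smul c y)\<close> consistent with
  \<open>norm\<close>.\<close>

lemma face_value_half_plane:
  assumes x: "norm x \<le> n" and le: "\<And>s. s \<ge> 0 \<Longrightarrow> s * n \<le> norm (s *\<^sub>R x + smul c y)"
  obtains z where "z \<in> face_values x y n" "Re (J (c * z)) \<ge> 0"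
proof -
  \<comment> \<open>After division by \<open>s\<close>, the contribution of \<open>y\<close>
    vanishes as \<open>s\<close> grows.\<close>
  have nx: "n \<le> norm x"
  proof (rule ccontr)
    assume "\<not> n \<le> norm x"
    then obtain k :: nat where k: "real k * (n - norm x) > norm (smul c y)"
      using reals_Archimedean3[of "n - norm x"] by auto
    have "real k * n \<le> norm (real k *\<^sub>R x + smul c y)" by (rule le) simp
    also have "\<dots> \<le> real k * norm x + norm (smul c y)"
      using norm_triangle_ineq[of "real k *\<^sub>R x" "smul c y"] by simp
    finally show False using k by (simp add: algebra_simps)
  qed
  define M where "M = {(r *\<^sub>R smul c y + s *\<^sub>R x, s * n) | r s. r \<ge> 0 \<and> s \<ge> 0}"
  have MI: "(r *\<^sub>R smul c y + s *\<^sub>R x, s * n) \<in> M" if "r \<ge> 0" "s \<ge> 0" for r s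
    using that unfolding M_def by blast
  obtain q where q: "sublinear q" and dom: "dominated q = {u \<in> dominated norm. \<forall>(m, r)\<in>M. r \<le> u m}"
  proof (rule sublinear_cone_constraint[OF sublinear_norm, of M])
    show "(0, 0) \<in> M" using MI[of 0 0] by simp
  next
    fix m r m' r' assume "(m, r) \<in> M" "(m', r') \<in> M"
    then obtain a s a' s' where *: "m = a *\<^sub>R smul c y + s *\<^sub>R x" "r = s * n" "s \<ge> 0" "a \<ge> 0"
      "m' = a' *\<^sub>R smul c y + s' *\<^sub>R x" "r' = s' * n" "s' \<ge> 0" "a' \<ge> 0"
      unfolding M_def by blast
    then show "(m + m', r + r') \<in> M"
      using MI[of "a + a'" "s + s'"] by (simp add: scaleR_left_distrib ring_distribs add_ac)
  next
    fix b :: real and m r assume b: "b > 0" and "(m, r) \<in> M"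
    then obtain a s where *: "m = a *\<^sub>R smul c y + s *\<^sub>R x" "r = s * n" "s \<ge> 0" "a \<ge> 0"
      unfolding M_def by blast
    then show "(b *\<^sub>R m, b * r) \<in> M"
      using MI[of "b * a" "b * s"] b by (simp add: scaleR_right_distrib mult_ac)
  next
    fix m r assume "(m, r) \<in> M"
    then obtain a s where *: "m = a *\<^sub>R smul c y + s *\<^sub>R x" "r = s * n" "s \<ge> 0" "a \<ge> 0"
      unfolding M_def by blast
    \<comment> \<open>For \<open>a > 0\<close> this is the assumption at \<open>s / a\<close>
      multiplied by \<open>a\<close>; the limiting case \<open>a = 0\<close> is
      \<open>nx\<close>.\<close>
    show "r \<le> norm m"
    proof (cases "a = 0")
      case True
      then show ?thesis using * nx by (simp add: mult_left_mono)
    next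
      case False
      with * have a: "a > 0" by simp
      have "s / a * n \<le> norm ((s / a) *\<^sub>R x + smul c y)" using a * by (intro le) simp
      then have "a * (s / a * n) \<le> a * norm ((s / a) *\<^sub>R x + smul c y)"
        using a by (intro mult_left_mono) simp_all
      then have "a * (s / a * n) \<le> norm (a *\<^sub>R ((s / a) *\<^sub>R x + smul c y))"
        using a by simp
      then show ?thesis using a * by (simp add: scaleR_right_distrib add.commute)
    qed
  qed blast
  \<comment> \<open>Here the existence of extreme functionals serves as the Hahn-Banach theorem: it
    provides an element of \<open>dominated q\<close>.\<close>
  obtain u where "functional_face {u} (dominated q)" using extreme_dominated_exists[OF q] by blast
  then have "u \<in> dominated q" by (simp add: functional_face_def)
  then have u: "u \<in> dominated norm" "n \<le> u x" "0 \<le> u (smul c y)"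
    using MI[of 0 1] MI[of 1 0] unfolding dom by auto
  obtain \<phi> where \<phi>: "\<phi> \<in> dual_ball smul" "\<And>y. Re (J (blinfun_apply \<phi> y)) = u y"
    "blinfun_apply \<phi> x = of_real n"
    using dominated_face_value[OF x u(1,2)] by blast
  show ?thesis
  proof (rule that)
    show "blinfun_apply \<phi> y \<in> face_values x y n" by (rule apply_in_face_values[OF \<phi>(1,3)])
    show "0 \<le> Re (J (c * blinfun_apply \<phi> y))"
      using u(3) by (simp only: dual_apply_smul[OF \<phi>(1), symmetric] \<phi>(2))
  qed
qed

end

section \<open>Functionals on the space of continuous functions\<close>

lemma bcontfun_norm_attained:
  fixes h :: "'t::t2_space \<Rightarrow>\<^sub>C 'y::real_normed_vector"
  assumes "compact (UNIV :: 't set)"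
  obtains t where "norm (apply_bcontfun h t) = norm h"
proof -
  obtain t where t: "norm (apply_bcontfun h s) \<le> norm (apply_bcontfun h t)" for s
    using continuous_attains_sup[OF assms, of "\<lambda>t. norm (apply_bcontfun h t)"]
    by (auto intro: continuous_intros)
  then have "norm h \<le> norm (apply_bcontfun h t)" by (rule norm_bound)
  then show ?thesis using norm_bounded[of h t] by (intro that[of t]) simp
qed

context normed_over_embedding
begin

lemma normed_over_embedding_bcontfun:
  "normed_over_embedding (bcontfun_scale smul :: 'k \<Rightarrow> ('t::topological_space \<Rightarrow>\<^sub>C 'y) \<Rightarrow> _) J j"
  using normed_over_bcontfun complex_embedding_axioms
  by (rule normed_over_embedding.intro)

lemma evaluation_in_dual_ball:
  assumes \<psi>: "\<psi> \<in> dual_ball smul"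
  obtains \<phi> :: "('t::topological_space \<Rightarrow>\<^sub>C 'y) \<Rightarrow>\<^sub>L 'k" where "\<phi> \<in> dual_ball (bcontfun_scale smul)"
    "\<And>h. blinfun_apply \<phi> h = blinfun_apply \<psi> (apply_bcontfun h t)"
proof -
  define F where "F h = blinfun_apply \<psi> (apply_bcontfun h t)" for h :: "'t \<Rightarrow>\<^sub>C 'y"
  have le: "norm (F h) \<le> norm h" for h
    unfolding F_def using dual_apply_le[OF \<psi>] norm_bounded order_trans by blast
  have "bounded_linear F"
    by (rule bounded_linear_intro[where K = 1]) (use le in \<open>simp_all add: F_def blinfun.add_right blinfun.scaleR_right\<close>)
  then have apply_F: "blinfun_apply (Blinfun F) = F" by (rule bounded_linear_Blinfun_apply)
  have "norm (Blinfun F) \<le> 1" by (rule norm_blinfun_bound) (use le in \<open>simp_all add: apply_F\<close>)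
  moreover have "F (bcontfun_scale smul c h) = c * F h" for c h
    by (simp add: F_def dual_apply_smul[OF \<psi>])
  ultimately have "Blinfun F \<in> dual_ball (bcontfun_scale smul)"
    by (simp add: dual_ball_def dual_def apply_F)
  then show ?thesis using that apply_F by (simp add: F_def)
qed

section \<open>The criterion for orthogonality\<close>

lemma face_values_subset_extreme_values:
  fixes f g :: "'t::topological_space \<Rightarrow>\<^sub>C 'y"
  shows "face_values (apply_bcontfun f t) (apply_bcontfun g t) (norm f) \<subseteq> convex hull (extreme_values smul f g)"
proof -
  have "{blinfun_apply \<psi> (apply_bcontfun g t) | \<psi>. \<psi> extreme_point_of dual_ball smul \<and>
      blinfun_apply \<psi> (apply_bcontfun f t) = of_real (norm f)} \<subseteq> extreme_values smul f g"
    unfolding extreme_values_def by blast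
  then show ?thesis
    by (rule subset_trans[OF face_values_subset_convex_hull[OF norm_bounded] hull_mono])
qed

text \<open>The union is the projection to the plane of a set of pairs \<open>(t, w)\<close>. That
  set is closed by joint continuity and lies over a disc of radius \<open>norm g\<close>.\<close>

lemma compact_Union_face_values:
  fixes f g :: "'t::t2_space \<Rightarrow>\<^sub>C 'y"
  assumes K: "compact (UNIV :: 't set)"
  shows "compact (\<Union>t. J ` face_values (apply_bcontfun f t) (apply_bcontfun g t) (norm f))"
proof -
  define W where "W = {p :: 't \<times> complex. snd p \<in> range J \<and> (\<forall>s\<ge>0. \<forall>c. Re (J c * snd p)
    \<le> norm (smul c (apply_bcontfun g (fst p)) + s *\<^sub>R apply_bcontfun f (fst p)) - s * norm f)}"
  have cont: "continuous_on UNIV (\<lambda>p :: 't \<times> complex. apply_bcontfun h (fst p))"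
    for h :: "'t \<Rightarrow>\<^sub>C 'y"
    by (rule continuous_on_compose2[OF continuous_on_apply_bcontfun continuous_on_fst[OF continuous_on_id],
          where t = UNIV]) simp
  have "closed W"
    unfolding W_def
    by (intro closed_Collect_conj closed_Collect_all closed_Collect_imp closed_Collect_le
        open_Collect_const continuous_intros cont bounded_linear.continuous_on[OF bounded_linear_scale])
      (use closed_vimage[OF closed_range_J, of snd] in \<open>simp add: vimage_def continuous_on_snd\<close>)
  then have "compact ((UNIV \<times> cball 0 (norm g)) \<inter> W)"
    by (intro compact_Int_closed compact_Times K compact_cball)
  then have "compact (snd ` ((UNIV \<times> cball 0 (norm g)) \<inter> W))"
    by (rule compact_continuous_image[rotated]) (intro continuous_intros)
  also have "snd ` ((UNIV \<times> cball 0 (norm g)) \<inter> W) =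
      (\<Union>t. J ` face_values (apply_bcontfun f t) (apply_bcontfun g t) (norm f))" (is "?L = ?R")
  proof (intro equalityI subsetI)
    fix w assume "w \<in> ?L"
    then show "w \<in> ?R" by (auto simp: W_def J_image_face_values)
  next
    fix w assume "w \<in> ?R"
    then obtain t z where z: "z \<in> face_values (apply_bcontfun f t) (apply_bcontfun g t) (norm f)" "w = J z"
      by blast
    have "norm w \<le> norm g"
      using norm_face_values_le[OF z(1)] norm_bounded[of g t] by (simp add: z(2) norm_J)
    moreover have "w \<in> J ` face_values (apply_bcontfun f t) (apply_bcontfun g t) (norm f)" using z by blast
    then have "(t, w) \<in> W" unfolding J_image_face_values by (simp add: W_def)
    ultimately show "w \<in> ?L" by (intro image_eqI[of _ _ "(t, w)"]) auto
  qed
  finally show ?thesis .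
qed

text \<open>The sets \<open>T s\<close> are closed, nonempty by orthogonality and decreasing in
  \<open>s\<close>. By compactness they have a common point \<open>t\<close>, to which
  \<open>face_value_half_plane\<close> applies.\<close>

lemma birkhoff_james_half_plane:
  fixes f g :: "'t::t2_space \<Rightarrow>\<^sub>C 'y"
  assumes K: "compact (UNIV :: 't set)" and orth: "birkhoff_james (bcontfun_scale smul) f g"
  obtains t z where "z \<in> face_values (apply_bcontfun f t) (apply_bcontfun g t) (norm f)" "Re (J (c * z)) \<ge> 0"
proof -
  define T where "T s = {t. s * norm f \<le> norm (s *\<^sub>R apply_bcontfun f t + smul c (apply_bcontfun g t))}" for s
  have antimono: "t \<in> T s" if "t \<in> T r" "s \<le> r" for t s r
  proof -
    have "r *\<^sub>R apply_bcontfun f t + smul c (apply_bcontfun g t)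
        = (r - s) *\<^sub>R apply_bcontfun f t + (s *\<^sub>R apply_bcontfun f t + smul c (apply_bcontfun g t))"
      by (simp add: algebra_simps)
    also have "norm \<dots> \<le> norm ((r - s) *\<^sub>R apply_bcontfun f t)
        + norm (s *\<^sub>R apply_bcontfun f t + smul c (apply_bcontfun g t))"
      by (rule norm_triangle_ineq)
    also have "norm ((r - s) *\<^sub>R apply_bcontfun f t) \<le> (r - s) * norm f"
      using that(2) by (simp add: mult_left_mono norm_bounded)
    finally show ?thesis using that(1) by (simp add: T_def algebra_simps)
  qed
  have ne: "T s \<noteq> {}" if s: "s \<ge> 0" for s
  proof -
    have "s * norm f \<le> norm (s *\<^sub>R f + bcontfun_scale smul c g)"
    proof (cases "s = 0")
      case False
      with s have s: "s > 0" by simp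
      interpret C: normed_over_embedding "bcontfun_scale smul :: 'k \<Rightarrow> ('t \<Rightarrow>\<^sub>C 'y) \<Rightarrow> _" J j
        by (rule normed_over_embedding_bcontfun)
      \<comment> \<open>Orthogonality is used with the scalar \<open>c / s\<close> and the result
        multiplied by \<open>s\<close>.\<close>
      have "norm f \<le> norm (f + bcontfun_scale smul (inverse s *\<^sub>R c) g)"
        using orth by (simp add: birkhoff_james_def)
      then have "s * norm f \<le> norm (s *\<^sub>R (f + inverse s *\<^sub>R bcontfun_scale smul c g))"
        using s by (simp add: C.smul_scaleR mult_left_mono)
      then show ?thesis using s by (simp add: scaleR_add_right)
    qed simp
    moreover obtain t where "norm (apply_bcontfun (s *\<^sub>R f + bcontfun_scale smul c g) t)
        = norm (s *\<^sub>R f + bcontfun_scale smul c g)"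
      using bcontfun_norm_attained[OF K] by blast
    ultimately have "t \<in> T s" by (simp add: T_def plus_bcontfun.rep_eq)
    then show ?thesis by blast
  qed
  have closed: "closed (T s)" for s
    unfolding T_def
    by (intro closed_Collect_le continuous_intros continuous_on_apply_bcontfun
        bounded_linear.continuous_on[OF bounded_linear_scale])
  have "UNIV \<inter> (\<Inter>s\<in>{0..}. T s) \<noteq> {}"
  proof (rule compact_imp_fip_image[OF K])
    fix I :: "real set" assume I: "finite I" "I \<subseteq> {0..}"
    \<comment> \<open>Inserting 0 covers the empty family; the set at the largest index lies in all
      others.\<close>
    obtain t where t: "t \<in> T (Max (insert 0 I))" using ne[of "Max (insert 0 I)"] I(1) by auto
    have "t \<in> T s" if "s \<in> I" for s
      by (rule antimono[OF t]) (use that I(1) in simp)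
    then show "UNIV \<inter> (\<Inter>s\<in>I. T s) \<noteq> {}" by blast
  qed (rule closed)
  then obtain t where t: "t \<in> T s" if "s \<ge> 0" for s by auto
  have "\<And>s. s \<ge> 0 \<Longrightarrow> s * norm f \<le> norm (s *\<^sub>R apply_bcontfun f t + smul c (apply_bcontfun g t))"
    using t by (simp add: T_def)
  then show ?thesis
    using face_value_half_plane[OF norm_bounded[of f t], of c "apply_bcontfun g t"] that by blast
qed

lemma birkhoff_james_imp_zero_in_convex_hull:
  fixes f g :: "'t::t2_space \<Rightarrow>\<^sub>C 'y"
  assumes K: "compact (UNIV :: 't set)" and orth: "birkhoff_james (bcontfun_scale smul) f g"
  shows "0 \<in> convex hull (extreme_values smul f g)"
proof -
  define C where "C = (\<Union>t. face_values (apply_bcontfun f t) (apply_bcontfun g t) (norm f))"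
  have JC: "J ` C = (\<Union>t. J ` face_values (apply_bcontfun f t) (apply_bcontfun g t) (norm f))"
    by (simp add: C_def image_UN)
  have "0 \<in> convex hull (J ` C)"
  proof (rule ccontr)
    assume no: "0 \<notin> convex hull (J ` C)"
    have "closed (convex hull (J ` C))"
      unfolding JC by (intro compact_imp_closed compact_convex_hull compact_Union_face_values K)
    moreover have "convex hull (J ` C) \<noteq> {}"
    proof -
      obtain t z where "z \<in> face_values (apply_bcontfun f t) (apply_bcontfun g t) (norm f)"
        using birkhoff_james_half_plane[OF K orth] by blast
      then show ?thesis by (auto simp: C_def)
    qed
    ultimately obtain a b where a: "a \<in> convex hull (J ` C)" and b: "b > 0"
      and sep: "\<And>w. w \<in> convex hull (J ` C) \<Longrightarrow> inner a w > b"
      using separating_hyperplane_closed_0_inset[OF convex_convex_hull _ _ no] by blast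
    \<comment> \<open>The separating vector is taken inside the hull, hence in the range of
      \<open>J\<close>, and so comes from a scalar.\<close>
    obtain v where v: "a = J v"
      using a unfolding convex_hull_linear_image[OF linear_J, symmetric] by blast
    obtain c where c: "J c = cnj (J v)" using exists_cnj_J by blast
    \<comment> \<open>The inner product with \<open>a\<close> is the real part of multiplication by
      \<open>c\<close>; the factor \<open>- c\<close> yields a face value on the wrong side of the
      hyperplane.\<close>
    obtain t z where z: "z \<in> face_values (apply_bcontfun f t) (apply_bcontfun g t) (norm f)"
      "Re (J (- c * z)) \<ge> 0"
      using birkhoff_james_half_plane[OF K orth] by blast
    have "inner a (J z) > b"
      using z(1) by (intro sep hull_inc) (auto simp: C_def)
    moreover have "inner a (J z) = Re (J (c * z))"
      by (simp add: v J_mult c inner_complex_def)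
    ultimately show False using z(2) b by (simp add: linear_neg[OF linear_J])
  qed
  then obtain z where z: "z \<in> convex hull C" "J z = 0"
    unfolding convex_hull_linear_image[OF linear_J, symmetric] by force
  have "z = 0" using z(2) inj_J linear_0[OF linear_J] by (metis injD)
  moreover have "convex hull C \<subseteq> convex hull (extreme_values smul f g)"
    using face_values_subset_extreme_values by (intro hull_minimal) (auto simp: C_def)
  ultimately show ?thesis using z(1) by blast
qed

text \<open>For fixed \<open>c\<close>, the scalars \<open>z\<close> with \<open>norm (of_real (norm
  f) + c * z) \<le> norm (f + bcontfun_scale smul c g)\<close> form a convex set that contains all
  extreme values. That 0 lies in it is the claim.\<close>

lemma zero_in_convex_hull_imp_birkhoff_james:
  fixes f g :: "'t::topological_space \<Rightarrow>\<^sub>C 'y"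
  assumes "0 \<in> convex hull (extreme_values smul f g)"
  shows "birkhoff_james (bcontfun_scale smul) f g"
  unfolding birkhoff_james_def
proof
  fix c
  let ?S = "{z. norm (of_real (norm f) + c * z) \<le> norm (f + bcontfun_scale smul c g)}"
  have "convex ?S"
  proof (rule convexI)
    fix z w and a b :: real
    assume z: "z \<in> ?S" "w \<in> ?S" and ab: "0 \<le> a" "0 \<le> b" "a + b = 1"
    have "of_real (norm f) + c * (a *\<^sub>R z + b *\<^sub>R w) =
        a *\<^sub>R (of_real (norm f) + c * z) + b *\<^sub>R (of_real (norm f) + c * w)"
      using scaleR_left_distrib[of a b "of_real (norm f) :: 'k"] ab(3) by (simp add: algebra_simps)
    also have "norm \<dots> \<le> a * norm (of_real (norm f) + c * z) + b * norm (of_real (norm f) + c * w)"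
      using ab by (intro norm_triangle_le) simp
    also have "\<dots> \<le> norm (f + bcontfun_scale smul c g)"
      by (rule convex_bound_le) (use z ab in simp_all)
    finally show "a *\<^sub>R z + b *\<^sub>R w \<in> ?S" by simp
  qed
  moreover have "extreme_values smul f g \<subseteq> ?S"
  proof
    fix z assume "z \<in> extreme_values smul f g"
    then obtain t \<psi> where \<psi>: "\<psi> \<in> dual_ball smul" "blinfun_apply \<psi> (apply_bcontfun f t) = of_real (norm f)"
      "z = blinfun_apply \<psi> (apply_bcontfun g t)"
      by (auto simp: extreme_values_def extreme_point_of_def)
    have "of_real (norm f) + c * z = blinfun_apply \<psi> (apply_bcontfun (f + bcontfun_scale smul c g) t)"
      by (simp add: plus_bcontfun.rep_eq blinfun.add_right dual_apply_smul[OF \<psi>(1)] \<psi>)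
    also have "norm \<dots> \<le> norm (f + bcontfun_scale smul c g)"
      using dual_apply_le[OF \<psi>(1)] norm_bounded order_trans by blast
    finally show "z \<in> ?S" by simp
  qed
  ultimately have "0 \<in> ?S" using assms hull_minimal[of _ ?S convex] by blast
  then show "norm f \<le> norm (f + bcontfun_scale smul c g)" by simp
qed

section \<open>The criterion for smoothness\<close>

lemma extreme_values_nonempty:
  fixes f g :: "'t::t2_space \<Rightarrow>\<^sub>C 'y"
  assumes K: "compact (UNIV :: 't set)"
  shows "extreme_values smul f g \<noteq> {}"
proof -
  \<comment> \<open>The admissible pairs of \<open>t\<close> and \<open>\<psi>\<close> do not depend
    on \<open>g\<close>, so it suffices to treat \<open>g = 0\<close>, to which every
    \<open>f\<close> is orthogonal.\<close>
  have "bcontfun_scale smul c (0 :: 't \<Rightarrow>\<^sub>C 'y) = 0" for c by (rule bcontfun_eqI) simp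
  then have "birkhoff_james (bcontfun_scale smul) f (0 :: 't \<Rightarrow>\<^sub>C 'y)"
    by (simp add: birkhoff_james_def)
  from birkhoff_james_imp_zero_in_convex_hull[OF K this]
  have "extreme_values smul f (0 :: 't \<Rightarrow>\<^sub>C 'y) \<noteq> {}" by auto
  then show ?thesis unfolding extreme_values_def by blast
qed

text \<open>The functional is evaluation at \<open>t\<close> followed by \<open>\<psi>\<close>. Its
  norm is at most 1, and the value at the nonzero \<open>f\<close> makes it equal to 1.\<close>

lemma extreme_values_norming_functional:
  fixes f g :: "'t::topological_space \<Rightarrow>\<^sub>C 'y"
  assumes "z \<in> extreme_values smul f g" and f: "f \<noteq> 0"
  obtains \<phi> where "\<phi> \<in> dual (bcontfun_scale smul)" "norm \<phi> = 1"
    "blinfun_apply \<phi> f = of_real (norm f)" "blinfun_apply \<phi> g = z"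
proof -
  obtain t \<psi> where \<psi>: "\<psi> \<in> dual_ball smul" "blinfun_apply \<psi> (apply_bcontfun f t) = of_real (norm f)"
    "z = blinfun_apply \<psi> (apply_bcontfun g t)"
    using assms(1) by (auto simp: extreme_values_def extreme_point_of_def)
  obtain \<phi> :: "('t \<Rightarrow>\<^sub>C 'y) \<Rightarrow>\<^sub>L 'k" where \<phi>: "\<phi> \<in> dual_ball (bcontfun_scale smul)"
    "\<And>h. blinfun_apply \<phi> h = blinfun_apply \<psi> (apply_bcontfun h t)"
    using evaluation_in_dual_ball[OF \<psi>(1)] by blast
  have "norm f \<le> norm \<phi> * norm f"
    using norm_blinfun[of \<phi> f] by (simp add: \<phi>(2) \<psi>(2))
  then have "norm \<phi> = 1" using \<phi>(1) f by (simp add: dual_ball_def)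
  then show ?thesis using that[of \<phi>] \<phi> \<psi> by (simp add: dual_ball_def)
qed

lemma norming_functional_value:
  fixes f h :: "'t::t2_space \<Rightarrow>\<^sub>C 'y"
  assumes K: "compact (UNIV :: 't set)" and f: "f \<noteq> 0"
    and \<phi>: "\<phi> \<in> dual_ball (bcontfun_scale smul)" "blinfun_apply \<phi> f = of_real (norm f)"
    and E: "extreme_values smul f h = {v}"
  shows "blinfun_apply \<phi> h = v"
proof -
  interpret C: normed_over_embedding "bcontfun_scale smul :: 'k \<Rightarrow> ('t \<Rightarrow>\<^sub>C 'y) \<Rightarrow> _" J j
    by (rule normed_over_embedding_bcontfun)
  \<comment> \<open>This choice of \<open>a\<close> puts \<open>k\<close> into the kernel of
    \<open>\<phi>\<close>.\<close>
  define a where "a = blinfun_apply \<phi> h / of_real (norm f)"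
  define k where "k = h - bcontfun_scale smul a f"
  have \<phi>k: "blinfun_apply \<phi> k = 0"
    using f by (simp add: k_def a_def blinfun.diff_right C.dual_apply_smul[OF \<phi>(1)] \<phi>(2))
  have "norm f \<le> norm (f + bcontfun_scale smul c k)" for c
    using C.dual_apply_le[OF \<phi>(1), of "f + bcontfun_scale smul c k"]
    by (simp add: blinfun.add_right C.dual_apply_smul[OF \<phi>(1)] \<phi>(2) \<phi>k)
  then have "birkhoff_james (bcontfun_scale smul) f k" by (simp add: birkhoff_james_def)
  then have "0 \<in> convex hull (extreme_values smul f k)"
    by (rule birkhoff_james_imp_zero_in_convex_hull[OF K])
  \<comment> \<open>On \<open>f t\<close> each admissible \<open>\<psi>\<close> takes the value
    \<open>norm f\<close>, so passing from \<open>h\<close> to \<open>k\<close> subtracts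
    \<open>\<phi> h\<close> from the extreme value.\<close>
  moreover have "extreme_values smul f k \<subseteq> {v - blinfun_apply \<phi> h}"
  proof
    fix z assume "z \<in> extreme_values smul f k"
    then obtain t \<psi> where \<psi>: "\<psi> extreme_point_of dual_ball smul"
      "blinfun_apply \<psi> (apply_bcontfun f t) = of_real (norm f)" "z = blinfun_apply \<psi> (apply_bcontfun k t)"
      by (auto simp: extreme_values_def)
    then have "blinfun_apply \<psi> (apply_bcontfun h t) \<in> extreme_values smul f h"
      unfolding extreme_values_def by blast
    then have "blinfun_apply \<psi> (apply_bcontfun h t) = v" by (simp add: E)
    moreover have "\<psi> \<in> dual_ball smul" using \<psi>(1) by (simp add: extreme_point_of_def)
    ultimately show "z \<in> {v - blinfun_apply \<phi> h}"
      using f by (simp add: \<psi> k_def a_def minus_bcontfun.rep_eq blinfun.diff_right dual_apply_smul)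
  qed
  then have "convex hull (extreme_values smul f k) \<subseteq> {v - blinfun_apply \<phi> h}"
    by (rule hull_minimal) simp
  ultimately show ?thesis by auto
qed

lemma smooth_point_imp_singleton_extreme_values:
  fixes f h :: "'t::t2_space \<Rightarrow>\<^sub>C 'y"
  assumes K: "compact (UNIV :: 't set)" and smooth: "smooth_point (bcontfun_scale smul) f"
  shows "is_singleton (extreme_values smul f h)"
proof -
  obtain \<phi> where \<phi>: "{\<phi> \<in> dual (bcontfun_scale smul). norm \<phi> = 1 \<and> blinfun_apply \<phi> f = of_real (norm f)} = {\<phi>}"
    using smooth by (auto simp: smooth_point_def is_singleton_def)
  have f: "f \<noteq> 0"
  proof
    assume f: "f = 0"
    have "\<phi> \<in> dual (bcontfun_scale smul)" "norm \<phi> = 1" using \<phi> by auto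
    \<comment> \<open>At \<open>f = 0\<close> every functional of norm 1 is norming, in particular
      \<open>- \<phi>\<close>.\<close>
    then have "- \<phi> \<in> {\<phi> \<in> dual (bcontfun_scale smul). norm \<phi> = 1 \<and> blinfun_apply \<phi> f = of_real (norm f)}"
      by (simp add: f dual_def blinfun.minus_left)
    then have "- \<phi> = \<phi>" unfolding \<phi> by simp
    then have "\<phi> + \<phi> = 0" by (metis add.left_inverse)
    then have "\<phi> = 0" by (simp flip: scaleR_2)
    with \<open>norm \<phi> = 1\<close> show False by simp
  qed
  have "z = blinfun_apply \<phi> h" if "z \<in> extreme_values smul f h" for z
    using extreme_values_norming_functional[OF that f] \<phi> by blast
  then have "extreme_values smul f h = {blinfun_apply \<phi> h}"
    using extreme_values_nonempty[OF K] by blast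
  then show ?thesis by simp
qed

lemma singleton_extreme_values_imp_smooth_point:
  fixes f :: "'t::t2_space \<Rightarrow>\<^sub>C 'y"
  assumes K: "compact (UNIV :: 't set)" and Y: "\<exists>y::'y. y \<noteq> 0"
    and sing: "\<And>h. is_singleton (extreme_values smul f h)"
  shows "smooth_point (bcontfun_scale smul) f"
proof -
  \<comment> \<open>For \<open>f = 0\<close> and a constant function with value \<open>y\<close>,
    both \<open>norm y\<close> and \<open>- norm y\<close> are face values, which contradicts the
    singleton assumption.\<close>
  have f: "f \<noteq> 0"
  proof
    assume f: "f = 0"
    obtain y :: 'y where y: "y \<noteq> 0" using Y by blast
    let ?h = "const_bcontfun y :: 't \<Rightarrow>\<^sub>C 'y"
    obtain v where v: "extreme_values smul f ?h = {v}" using sing by (auto simp: is_singleton_def)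
    have in_face: "of_real r \<in> face_values 0 y 0" if "\<bar>r\<bar> = norm y" for r
      unfolding face_values_def
    proof (intro CollectI allI impI)
      fix c
      have "Re (J (c * of_real r)) \<le> norm (c * of_real r)"
        using complex_Re_le_cmod[of "J (c * of_real r)"] by (simp only: norm_J)
      then show "Re (J (c * of_real r)) \<le> norm (smul c y + s *\<^sub>R 0) - s * 0" for s
        using that by (simp add: norm_mult norm_scale)
    qed
    have "face_values 0 y 0 \<subseteq> {v}"
      using face_values_subset_extreme_values[of f _ ?h] v f by simp
    then have "of_real (norm y) = v" "of_real (- norm y) = v"
      using in_face[of "norm y"] in_face[of "- norm y"] by auto
    then have "(of_real (norm y) :: 'k) = of_real (- norm y)" by simp
    then have "norm y = - norm y" by (simp only: of_real_eq_iff)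
    with y show False by simp
  qed
  \<comment> \<open>Any extreme value provides a norming functional; by
    \<open>norming_functional_value\<close> two of them agree at every \<open>h\<close>.\<close>
  obtain w where "w \<in> extreme_values smul f f" using extreme_values_nonempty[OF K] by blast
  then obtain \<phi> where \<phi>: "\<phi> \<in> dual (bcontfun_scale smul)" "norm \<phi> = 1" "blinfun_apply \<phi> f = of_real (norm f)"
    using extreme_values_norming_functional[OF _ f] by blast
  have "\<theta> = \<phi>" if \<theta>: "\<theta> \<in> dual (bcontfun_scale smul)" "norm \<theta> = 1" "blinfun_apply \<theta> f = of_real (norm f)" for \<theta>
  proof (rule blinfun_eqI)
    fix h
    obtain v where v: "extreme_values smul f h = {v}" using sing by (auto simp: is_singleton_def)
    have "blinfun_apply \<theta> h = v" "blinfun_apply \<phi> h = v"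
      using norming_functional_value[OF K f _ _ v] \<theta> \<phi> by (auto simp: dual_ball_def)
    then show "blinfun_apply \<theta> h = blinfun_apply \<phi> h" by simp
  qed
  then have "{\<phi> \<in> dual (bcontfun_scale smul). norm \<phi> = 1 \<and> blinfun_apply \<phi> f = of_real (norm f)} = {\<phi>}"
    using \<phi> by blast
  then show ?thesis by (simp add: smooth_point_def)
qed

end

theorem corollary3p5:
  fixes smul :: "'k::real_or_complex \<Rightarrow> 'y::banach \<Rightarrow> 'y"
    and f g :: "'t::t2_space \<Rightarrow>\<^sub>C 'y"
  assumes "compact (UNIV :: 't set)"
    and "normed_over smul"
    and "\<exists>y::'y. y \<noteq> 0"
  shows "(birkhoff_james (bcontfun_scale smul) f g \<longleftrightarrow>
            0 \<in> convex hull (extreme_values smul f g)) \<and>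
         (smooth_point (bcontfun_scale smul) f \<longleftrightarrow>
            (\<forall>h. is_singleton (extreme_values smul f h)))"
proof -
  obtain J :: "'k \<Rightarrow> complex" and j where "complex_embedding J j"
    by (rule complex_embedding_exists)
  with assms(2) interpret normed_over_embedding smul J j
    by (rule normed_over_embedding.intro)
  show ?thesis
    using birkhoff_james_imp_zero_in_convex_hull[OF assms(1)] zero_in_convex_hull_imp_birkhoff_james
      smooth_point_imp_singleton_extreme_values[OF assms(1)]
      singleton_extreme_values_imp_smooth_point[OF assms(1,3)]
    by blast
qed

end
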